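(* Let $\mathcal{B}$ be Bring's curve $\{\sum_{i=1}^5 x_i=\sum_{i=1}^5x_i^2=\sum_{i=1}^5x_i^3=0\}\subset\mathbb{P}^4$ over $\mathbb{C}$, with $S_5$ acting by permuting coordinates. The quotient $\mathcal{B}/\langle(12),(345)\rangle$ is isomorphic over $\mathbb{C}$ to the elliptic curve $$y^2=432\left[x^3+80x^2+125x+50\right],$$ which has $j$-invariant $-\dfrac{5^2\times241^3}{2^3}$.
   Context: The $j$-invariant is normalised so that $j=1728$ for $y^2=x^3-x$. *)

theory Defs
  imports
    "HOL-Analysis.Analysis"
    "HOL-Algebra.Generated_Groups"
    "HOL-Algebra.Group_Action"
    "HOL-Combinatorics.Cycles"
begin

section \<open>Spaces with functions\<close>

text \<open>
  Complex varieties and their quotients are treated as spaces with functions: a topological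
  space together with, for every open set \<open>U\<close>, the complex-valued functions that are regular
  on \<open>U\<close>. As HOL functions are total, membership of \<open>f\<close> in \<open>regular X U\<close> is meant to depend
  only on the values of \<open>f\<close> on \<open>U\<close>.
\<close>

record 'a fun_space =
  fspace_top :: "'a topology"
  regular :: "'a set \<Rightarrow> ('a \<Rightarrow> complex) set"

definition morphism :: "'a fun_space \<Rightarrow> 'b fun_space \<Rightarrow> ('a \<Rightarrow> 'b) \<Rightarrow> bool" where
  "morphism X Y h \<longleftrightarrow>
     continuous_map (fspace_top X) (fspace_top Y) h \<and>
     (\<forall>V f. openin (fspace_top Y) V \<and> f \<in> regular Y V \<longrightarrow>
        f \<circ> h \<in> regular X {x \<in> topspace (fspace_top X). h x \<in> V})"

definition isomorphic :: "'a fun_space \<Rightarrow> 'b fun_space \<Rightarrow> bool" where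
  "isomorphic X Y \<longleftrightarrow>
     (\<exists>h k. morphism X Y h \<and> morphism Y X k \<and>
        (\<forall>x \<in> topspace (fspace_top X). k (h x) = x) \<and>
        (\<forall>y \<in> topspace (fspace_top Y). h (k y) = y))"


section \<open>Complex projective varieties\<close>

text \<open>The points are the lines through the origin, so \<open>'n\<close> indexes homogeneous coordinates.\<close>

definition proj_space :: "(complex ^ 'n) set set" where
  "proj_space = {vec.span {v} | v. v \<noteq> 0}"

text \<open>
  Homogeneous polynomials of degree \<open>d\<close>, as functions (\<open>\<complex>\<close> is infinite). The zero polynomial
  is a form of every degree.
\<close>

inductive form :: "nat \<Rightarrow> (complex ^ 'n \<Rightarrow> complex) \<Rightarrow> bool" where
  form_const: "form 0 (\<lambda>v. c)"
| form_coord: "form 1 (\<lambda>v. v $ i)"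
| form_add: "form d F \<Longrightarrow> form d G \<Longrightarrow> form d (\<lambda>v. F v + G v)"
| form_mult: "form d F \<Longrightarrow> form e G \<Longrightarrow> form (d + e) (\<lambda>v. F v * G v)"

definition zariski :: "(complex ^ 'n) set set \<Rightarrow> (complex ^ 'n) set topology" where
  "zariski X = subtopology
     (topology_generated_by
        {{L \<in> proj_space. \<forall>v \<in> L - {0}. F v \<noteq> 0} | d F. form d F}) X"

definition regular_on ::
    "(complex ^ 'n) set set \<Rightarrow> (complex ^ 'n) set set \<Rightarrow> ((complex ^ 'n) set \<Rightarrow> complex) \<Rightarrow> bool"
  where
  "regular_on X U f \<longleftrightarrow>
     (\<forall>P \<in> U. \<exists>W d F G. openin (zariski X) W \<and> P \<in> W \<and> W \<subseteq> U \<and> form d F \<and> form d G \<and>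
        (\<forall>L \<in> W. \<forall>v \<in> L - {0}. G v \<noteq> 0 \<and> f L = F v / G v))"

definition variety :: "(complex ^ 'n) set set \<Rightarrow> (complex ^ 'n) set fun_space" where
  "variety X = \<lparr>fspace_top = zariski X, regular = (\<lambda>U. {f. regular_on X U f})\<rparr>"


section \<open>Quotients by group actions\<close>

definition quotient_topology :: "'a topology \<Rightarrow> ('a \<Rightarrow> 'b) \<Rightarrow> 'b topology" where
  "quotient_topology T q =
     topology (\<lambda>U. U \<subseteq> q ` topspace T \<and> openin T {x \<in> topspace T. q x \<in> U})"

lemma openin_quotient_topology:
  "openin (quotient_topology T q) U \<longleftrightarrow>
     U \<subseteq> q ` topspace T \<and> openin T {x \<in> topspace T. q x \<in> U}"
proof -
  let ?pre = "\<lambda>U. {x \<in> topspace T. q x \<in> U}"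
  have "istopology (\<lambda>U. U \<subseteq> q ` topspace T \<and> openin T (?pre U))"
    unfolding istopology_def
  proof (intro conjI allI impI)
    fix A B
    assume A: "A \<subseteq> q ` topspace T \<and> openin T (?pre A)"
      and B: "B \<subseteq> q ` topspace T \<and> openin T (?pre B)"
    show "A \<inter> B \<subseteq> q ` topspace T"
      using A by (rule conjE) (rule le_infI1)
    have "?pre (A \<inter> B) = ?pre A \<inter> ?pre B"
      by (rule Set.set_eqI) (simp, iprover)
    then show "openin T (?pre (A \<inter> B))"
      using openin_Int[OF conjunct2[OF A] conjunct2[OF B]] by (simp only:)
  next
    fix K
    assume K: "\<forall>U\<in>K. U \<subseteq> q ` topspace T \<and> openin T (?pre U)"
    show "\<Union>K \<subseteq> q ` topspace T"
      using K by (simp only: Sup_le_iff) simp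
    have "?pre (\<Union>K) = \<Union>(?pre ` K)"
      by (rule Set.set_eqI) simp
    moreover have "openin T (\<Union>(?pre ` K))"
      by (rule openin_Union, erule imageE) (use K in simp)
    ultimately show "openin T (?pre (\<Union>K))"
      by (simp only:)
  qed
  then show ?thesis
    by (simp only: quotient_topology_def topology_inverse')
qed

lemma topspace_quotient_topology: "topspace (quotient_topology T q) = q ` topspace T"
proof (rule subset_antisym)
  show "topspace (quotient_topology T q) \<subseteq> q ` topspace T"
    by (rule conjunct1[OF iffD1[OF openin_quotient_topology openin_topspace]])
  have "{x \<in> topspace T. q x \<in> q ` topspace T} = topspace T"
    by (rule Set.set_eqI) (simp, iprover intro: imageI)
  then have "openin (quotient_topology T q) (q ` topspace T)"
    by (simp only: openin_quotient_topology openin_topspace) simp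
  then show "q ` topspace T \<subseteq> topspace (quotient_topology T q)"
    by (rule openin_subset)
qed

text \<open>
  The points are the orbits, and the functions regular on \<open>U\<close> are the invariant functions
  regular on the preimage of \<open>U\<close>. For a finite group acting on a projective variety this is the
  quotient variety.
\<close>

definition quotient_space ::
    "'a fun_space \<Rightarrow> ('g, 'm) monoid_scheme \<Rightarrow> ('g \<Rightarrow> 'a \<Rightarrow> 'a) \<Rightarrow> 'a set fun_space" where
  "quotient_space X G \<phi> =
     \<lparr>fspace_top = quotient_topology (fspace_top X) (orbit G \<phi>),
      regular = (\<lambda>U. {f. f \<circ> orbit G \<phi> \<in>
        regular X {x \<in> topspace (fspace_top X). orbit G \<phi> x \<in> U}})\<rparr>"


section \<open>Elliptic curves and the j-invariant\<close>

definition weierstrass_curve ::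
    "complex \<Rightarrow> complex \<Rightarrow> complex \<Rightarrow> complex \<Rightarrow> complex \<Rightarrow> (complex ^ 3) set set" where
  "weierstrass_curve a1 a2 a3 a4 a6 =
     {L \<in> proj_space. \<forall>v \<in> L.
        (v $ 2)\<^sup>2 * v $ 3 + a1 * v $ 1 * v $ 2 * v $ 3 + a3 * v $ 2 * (v $ 3)\<^sup>2 =
        (v $ 1) ^ 3 + a2 * (v $ 1)\<^sup>2 * v $ 3 + a4 * v $ 1 * (v $ 3)\<^sup>2 + a6 * (v $ 3) ^ 3}"

definition weierstrass_c4 ::
    "complex \<Rightarrow> complex \<Rightarrow> complex \<Rightarrow> complex \<Rightarrow> complex \<Rightarrow> complex" where
  "weierstrass_c4 a1 a2 a3 a4 a6 = (a1\<^sup>2 + 4 * a2)\<^sup>2 - 24 * (2 * a4 + a1 * a3)"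

definition weierstrass_disc ::
    "complex \<Rightarrow> complex \<Rightarrow> complex \<Rightarrow> complex \<Rightarrow> complex \<Rightarrow> complex" where
  "weierstrass_disc a1 a2 a3 a4 a6 =
     (let b2 = a1\<^sup>2 + 4 * a2;
          b4 = 2 * a4 + a1 * a3;
          b6 = a3\<^sup>2 + 4 * a6;
          b8 = a1\<^sup>2 * a6 + 4 * a2 * a6 - a1 * a3 * a4 + a2 * a3\<^sup>2 - a4\<^sup>2
      in - b2\<^sup>2 * b8 - 8 * b4 ^ 3 - 27 * b6\<^sup>2 + 9 * b2 * b4 * b6)"

definition weierstrass_j ::
    "complex \<Rightarrow> complex \<Rightarrow> complex \<Rightarrow> complex \<Rightarrow> complex \<Rightarrow> complex" where
  "weierstrass_j a1 a2 a3 a4 a6 =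
     weierstrass_c4 a1 a2 a3 a4 a6 ^ 3 / weierstrass_disc a1 a2 a3 a4 a6"

lemma weierstrass_j_normalisation: "weierstrass_j 0 0 0 (-1) 0 = 1728"
  by (simp add: weierstrass_j_def weierstrass_c4_def weierstrass_disc_def)

text \<open>
  An elliptic curve is a curve isomorphic to a nonsingular Weierstrass cubic; its j-invariant is
  that of any such Weierstrass model.
\<close>

definition elliptic_curve_with_j :: "'a fun_space \<Rightarrow> complex \<Rightarrow> bool" where
  "elliptic_curve_with_j X j \<longleftrightarrow>
     (\<exists>a1 a2 a3 a4 a6. weierstrass_disc a1 a2 a3 a4 a6 \<noteq> 0 \<and>
        isomorphic X (variety (weierstrass_curve a1 a2 a3 a4 a6)) \<and>
        weierstrass_j a1 a2 a3 a4 a6 = j)"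


section \<open>Bring's curve\<close>

text \<open>In the type \<open>5\<close> the elements are \<open>1, 2, 3, 4\<close> and \<open>5 = 0\<close>.\<close>

definition bring_curve :: "(complex ^ 5) set set" where
  "bring_curve =
     {L \<in> proj_space. \<forall>x \<in> L.
        (\<Sum>i\<in>UNIV. x $ i) = 0 \<and> (\<Sum>i\<in>UNIV. (x $ i)\<^sup>2) = 0 \<and> (\<Sum>i\<in>UNIV. (x $ i) ^ 3) = 0}"

text \<open>The left action of permutations: the \<open>p i\<close>-th coordinate of the image of \<open>x\<close> is \<open>x $ i\<close>.\<close>

definition permute_coords :: "('n \<Rightarrow> 'n) \<Rightarrow> (complex ^ 'n) set \<Rightarrow> (complex ^ 'n) set" where
  "permute_coords p L = (\<lambda>x. \<chi> i. x $ inv_into UNIV p i) ` L"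

abbreviation S5 :: "(5 \<Rightarrow> 5) monoid" where
  "S5 \<equiv> BijGroup UNIV"

text \<open>The projective closure of \<open>y\<^sup>2 = 432 (x\<^sup>3 + 80 x\<^sup>2 + 125 x + 50)\<close>.\<close>

definition quotient_model :: "(complex ^ 3) set set" where
  "quotient_model =
     {L \<in> proj_space. \<forall>v \<in> L.
        (v $ 2)\<^sup>2 * v $ 3 =
        432 * ((v $ 1) ^ 3 + 80 * (v $ 1)\<^sup>2 * v $ 3 + 125 * v $ 1 * (v $ 3)\<^sup>2 + 50 * (v $ 3) ^ 3)}"

end

theory Submission
  imports Defs "HOL-Computational_Algebra.Fundamental_Theorem_Algebra"
begin

text \<open>
  On Bring's curve write \<open>s = x\<^sub>1 + x\<^sub>2\<close>, \<open>p = x\<^sub>1 x\<^sub>2\<close> and \<open>\<delta> = (x\<^sub>3 - x\<^sub>4) (x\<^sub>4 - x\<^sub>5) (x\<^sub>5 - x\<^sub>3)\<close>. These are invariant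
  under \<open>(1 2)\<close> and \<open>(3 4 5)\<close>. By Newton's identities the three equations of the curve say that
  \<open>x\<^sub>3, x\<^sub>4, x\<^sub>5\<close> are the roots of \<open>t\<^sup>3 + s t\<^sup>2 + (s\<^sup>2 - p) t - (2 s p - s\<^sup>3)\<close>, so every invariant polynomial
  becomes a polynomial in \<open>s, p, \<delta>\<close> (lemma \<open>descends_symmetrise\<close>), and \<open>\<delta>\<^sup>2\<close> is the discriminant
  of that cubic:
  \<open>\<delta>\<^sup>2 = 4 p\<^sup>3 - 83 s\<^sup>2 p\<^sup>2 + 72 s\<^sup>4 p - 16 s\<^sup>6\<close>.
  The quotient is therefore this curve in the weighted projective plane with weights 1, 2, 3, which
  is where Weierstrass cubics live: the forms \<open>s\<^sup>3 - 4 s p\<close>, \<open>48 \<i> \<surd>3 \<delta>\<close>, \<open>s\<^sup>3\<close> of degree 3 map Bring's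
  curve onto the given cubic.

  What has to be checked is that this map is the quotient map for the points, the topology and the
  regular functions. Its fibres are the orbits (\<open>orbit_eq_fibre\<close>), since the multiset of the \<open>x\<^sub>1, x\<^sub>2\<close>
  and that of the \<open>x\<^sub>3, x\<^sub>4, x\<^sub>5\<close> can be read off from \<open>s\<close> and \<open>p\<close>, and \<open>\<delta>\<close> fixes the cyclic order; it is
  onto, because the roots exist over the complex numbers. For the topology and the functions the
  essential point is \<open>symmetrise_pullback\<close>: an invariant form of degree \<open>3 m\<close> is, on Bring's curve,
  the pullback of a form of degree \<open>m\<close>. Invariant forms are produced by summing over the group; as
  power sums detect whether a finite family of numbers vanishes, some power of a form that is
  nonzero at a given point has a nonzero sum there (\<open>symmetrise_power_nonzero\<close>). Hence a basic open
  neighbourhood inside a saturated open set, or the fraction describing an invariant function, can be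
  replaced by one that comes from the cubic (\<open>quotient_map_open\<close>, \<open>quotient_map_reflects_regular\<close>).

  The j-invariant is read off after rescaling the cubic to a monic Weierstrass equation.
\<close>


section \<open>Lines, forms and the Zariski topology\<close>

lemma span_line: "vec.span {v} = range (\<lambda>c. c *s v)"
  by (rule vec.span_singleton)

lemma line_eqI: "vec.span {v} = vec.span {w}" if "v = c *s w" "c \<noteq> 0" for v w :: "complex ^ 'n"
proof -
  have "w = inverse c *s v" using that by simp
  then show ?thesis
    using that vec.span_scale[OF vec.span_base, of v "{v}" "inverse c"]
    by (intro vec.span_eq[THEN iffD2]) (auto intro: vec.span_scale vec.span_base)
qed

lemma line_eqD:
  fixes v w :: "complex ^ 'n"
  assumes "vec.span {v} = vec.span {w}" "v \<noteq> 0"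
  obtains c where "c \<noteq> 0" "v = c *s w"
proof -
  have "v \<in> vec.span {w}" using assms vec.span_base[of v "{v}"] by simp
  then obtain c where "v = c *s w" by (auto simp: span_line)
  moreover have "c \<noteq> 0" using calculation assms by auto
  ultimately show ?thesis using that by blast
qed

lemma line_in_proj_space: "v \<noteq> 0 \<Longrightarrow> vec.span {v} \<in> proj_space"
  by (auto simp: proj_space_def)

lemma proj_space_line:
  assumes "L \<in> proj_space" "v \<in> L - {0}"
  shows "L = vec.span {v}"
proof -
  obtain w where w: "L = vec.span {w}" using assms by (auto simp: proj_space_def)
  with assms obtain c where "v = c *s w" "c \<noteq> 0" by (auto simp: span_line)
  then show ?thesis using line_eqI w by metis
qed

lemma proj_spaceE:
  assumes "L \<in> proj_space"
  obtains v where "v \<noteq> 0" "L = vec.span {v}"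
  using assms by (auto simp: proj_space_def)

lemma form_scale: "form d F \<Longrightarrow> F (c *s v) = c ^ d * F v"
  by (induction rule: form.induct) (simp_all add: algebra_simps power_add)

lemma form_mult': "form d F \<Longrightarrow> form e G \<Longrightarrow> n = d + e \<Longrightarrow> form n (\<lambda>v. F v * G v)"
  using form_mult by blast

lemma form_smult: "form d F \<Longrightarrow> form d (\<lambda>v. c * F v)"
  using form_mult[OF form_const] by fastforce

lemma form_diff: "form d F \<Longrightarrow> form d G \<Longrightarrow> form d (\<lambda>v. F v - G v)"
  using form_add[OF _ form_smult[of d G "-1"]] by simp

lemma form_power: "form d F \<Longrightarrow> form (d * k) (\<lambda>v. F v ^ k)"
proof (induction k)
  case 0
  then show ?case using form_const[of 1] by simp
next
  case (Suc k)
  then show ?case by (auto intro: form_mult')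
qed

lemma form_compose:
  fixes P :: "complex ^ 'n \<Rightarrow> complex ^ 'm"
  assumes P: "\<And>i. form e (\<lambda>v. P v $ i)" and "form d F"
  shows "form (d * e) (\<lambda>v. F (P v))"
  using assms(2)
proof (induction rule: form.induct)
  case (form_mult d F d' G)
  then show ?case by (auto intro: form_mult' simp: algebra_simps)
qed (use P in \<open>auto intro: form.intros\<close>)

definition nonvanishing :: "(complex ^ 'n) set set \<Rightarrow> (complex ^ 'n \<Rightarrow> complex) \<Rightarrow> (complex ^ 'n) set set"
  where "nonvanishing X F = {L \<in> X. \<forall>v \<in> L - {0}. F v \<noteq> 0}"

lemma line_in_nonvanishing:
  assumes "form d F" "v \<noteq> 0"
  shows "vec.span {v} \<in> nonvanishing X F \<longleftrightarrow> vec.span {v} \<in> X \<and> F v \<noteq> 0"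
proof -
  have v: "v \<in> vec.span {v} - {0}" using assms by (simp add: vec.span_base)
  have "F w \<noteq> 0" if "F v \<noteq> 0" and w: "w \<in> vec.span {v} - {0}" for w
  proof -
    obtain c where "w = c *s v" "c \<noteq> 0" using w unfolding span_line by auto
    then show ?thesis using that(1) by (simp add: form_scale[OF assms(1)])
  qed
  with v have "(\<forall>w\<in>vec.span {v} - {0}. F w \<noteq> 0) \<longleftrightarrow> F v \<noteq> 0" by (intro iffI ballI) auto
  then show ?thesis by (simp only: nonvanishing_def mem_Collect_eq)
qed

lemma topspace_zariski:
  assumes "X \<subseteq> proj_space"
  shows "topspace (zariski X) = X"
proof -
  have "form 0 (\<lambda>v :: complex ^ 'a. 1)" by (rule form_const)
  moreover have "{L \<in> proj_space. \<forall>v \<in> L - {0}. (1::complex) \<noteq> 0} = proj_space" by simp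
  ultimately have "proj_space \<in> {{L \<in> proj_space. \<forall>v \<in> L - {0}. F v \<noteq> 0} |
          d (F :: complex ^ 'a \<Rightarrow> complex). form d F}"
    by (intro CollectI exI[of _ 0] exI[of _ "\<lambda>v. 1"] conjI) simp_all
  then have "X \<subseteq> \<Union>{{L \<in> proj_space. \<forall>v \<in> L - {0}. F v \<noteq> 0} |
          d (F :: complex ^ 'a \<Rightarrow> complex). form d F}"
    using assms by (meson Union_upper order_trans)
  then show ?thesis
    by (simp only: zariski_def topspace_subtopology topology_generated_by_topspace Int_absorb1)
qed

text \<open>
  The sets where a single form does not vanish are closed under intersection, by multiplying
  forms; so they are a basis of the topology and not merely a subbasis.
\<close>

lemma openin_zariski_iff:
  assumes X: "X \<subseteq> proj_space"
  shows "openin (zariski X) U \<longleftrightarrow>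
    U \<subseteq> X \<and> (\<forall>L\<in>U. \<exists>d F. form d F \<and> L \<in> nonvanishing X F \<and> nonvanishing X F \<subseteq> U)"
    (is "?lhs \<longleftrightarrow> ?rhs")
proof
  let ?\<S> = "{nonvanishing proj_space F | d (F :: complex ^ 'a \<Rightarrow> complex). form d F}"
  have zar: "zariski Y = subtopology (topology_generated_by ?\<S>) Y" for Y
    by (simp add: zariski_def nonvanishing_def)
  have int: "nonvanishing X F = nonvanishing proj_space F \<inter> X" for F
    using X by (auto simp: nonvanishing_def)
  {
    fix S
    assume "generate_topology_on ?\<S> S"
    then have "\<forall>L\<in>S. \<exists>d F. form d F \<and> L \<in> nonvanishing proj_space F \<and> nonvanishing proj_space F \<subseteq> S"
    proof induction
      case (Int A B)
      show ?case
      proof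
        fix L assume L: "L \<in> A \<inter> B"
        from L Int obtain d F where F: "form d F" "L \<in> nonvanishing proj_space F"
          "nonvanishing proj_space F \<subseteq> A" by blast
        from L Int obtain e G where G: "form e G" "L \<in> nonvanishing proj_space G"
          "nonvanishing proj_space G \<subseteq> B" by blast
        have eq: "nonvanishing proj_space (\<lambda>v. F v * G v)
            = nonvanishing proj_space F \<inter> nonvanishing proj_space G"
          by (auto simp: nonvanishing_def)
        show "\<exists>d F. form d F \<and> L \<in> nonvanishing proj_space F \<and> nonvanishing proj_space F \<subseteq> A \<inter> B"
          by (intro exI[of _ "d + e"] exI[of _ "\<lambda>v. F v * G v"])
            (use F G form_mult eq in auto)
      qed
    next
      case (UN K)
      then show ?case by (meson UnionE UnionI subset_iff)
    qed auto
  } note basis = this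
  {
    assume ?lhs
    then obtain S where S: "generate_topology_on ?\<S> S" "U = S \<inter> X"
      by (auto simp: zar openin_subtopology openin_topology_generated_by_iff)
    show ?rhs
    proof (intro conjI ballI)
      show "U \<subseteq> X" using S by blast
      fix L assume L: "L \<in> U"
      then obtain d F where "form d F" "L \<in> nonvanishing proj_space F" "nonvanishing proj_space F \<subseteq> S"
        using basis[OF S(1)] S(2) by blast
      then show "\<exists>d F. form d F \<and> L \<in> nonvanishing X F \<and> nonvanishing X F \<subseteq> U"
        using L S(2) int by (intro exI[of _ d] exI[of _ F]) auto
    qed
  }
  {
    assume r: ?rhs
    show ?lhs
    proof (subst openin_subopen, intro ballI)
      fix L assume "L \<in> U"
      with r obtain d F where F: "form d F" "L \<in> nonvanishing X F" "nonvanishing X F \<subseteq> U"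
        by blast
      have "openin (zariski X) (nonvanishing X F)"
        unfolding zar openin_subtopology int
        using F(1) by (blast intro: topology_generated_by_Basis)
      with F show "\<exists>T. openin (zariski X) T \<and> L \<in> T \<and> T \<subseteq> U" by blast
    qed
  }
qed

lemma openin_nonvanishing:
  assumes "X \<subseteq> proj_space" "form d F"
  shows "openin (zariski X) (nonvanishing X F)"
  using assms by (auto simp: openin_zariski_iff) (auto simp: nonvanishing_def)


section \<open>Regular functions and morphisms\<close>

text \<open>
  Multiplying a local fraction by a form that vanishes off the neighbourhood turns it into an
  identity \<open>f G = F\<close> on the whole of \<open>U\<close>. In this shape the description of a regular function
  can be pulled back, translated by a group and summed without keeping track of neighbourhoods.
\<close>

lemma regular_on_iff:
  assumes X: "X \<subseteq> proj_space" and U: "openin (zariski X) U"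
  shows "regular_on X U f \<longleftrightarrow>
    (\<forall>P\<in>U. \<exists>d F G. form d F \<and> form d G \<and> (\<forall>v\<in>P - {0}. G v \<noteq> 0) \<and>
       (\<forall>L\<in>U. \<forall>v\<in>L - {0}. f L * G v = F v))" (is "?lhs \<longleftrightarrow> ?rhs")
proof
  assume l: ?lhs
  show ?rhs
  proof
    fix P assume P: "P \<in> U"
    from bspec[OF l[unfolded regular_on_def] P]
    obtain W d F G where W: "openin (zariski X) W" "P \<in> W" "W \<subseteq> U" and
      F: "form d F" "form d G" and fr: "\<forall>L\<in>W. \<forall>v\<in>L - {0}. G v \<noteq> 0 \<and> f L = F v / G v"
      by (elim exE conjE) (rule that)
    from W X obtain e H where H: "form e H" "P \<in> nonvanishing X H" "nonvanishing X H \<subseteq> W"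
      unfolding openin_zariski_iff[OF X] by blast
    show "\<exists>d F G. form d F \<and> form d G \<and> (\<forall>v\<in>P - {0}. G v \<noteq> 0) \<and>
       (\<forall>L\<in>U. \<forall>v\<in>L - {0}. f L * G v = F v)"
    proof (intro exI conjI ballI)
      show "form (d + e) (\<lambda>v. F v * H v)" "form (d + e) (\<lambda>v. G v * H v)"
        using F H by (auto intro: form_mult)
      show "G v * H v \<noteq> 0" if "v \<in> P - {0}" for v
        using that fr W H by (auto simp: nonvanishing_def)
      show "f L * (G v * H v) = F v * H v" if L: "L \<in> U" "v \<in> L - {0}" for L v
      proof (cases "H v = 0")
        case False
        have LX: "L \<in> X" using L U X by (auto simp: openin_zariski_iff)
        then have "L = vec.span {v}" using X L proj_space_line by blast
        then have "L \<in> nonvanishing X H"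
          using LX L False line_in_nonvanishing[OF H(1), of v X] by auto
        then have "G v \<noteq> 0" "f L = F v / G v" using H fr L by blast+
        then show ?thesis by simp
      qed simp
    qed
  qed
next
  assume r: ?rhs
  show ?lhs
    unfolding regular_on_def
  proof
    fix P assume P: "P \<in> U"
    from bspec[OF r P] obtain d F G where F: "form d F" "form d G" "\<forall>v\<in>P - {0}. G v \<noteq> 0"
      and eq: "\<forall>L\<in>U. \<forall>v\<in>L - {0}. f L * G v = F v"
      by (elim exE conjE) (rule that)
    have UX: "U \<subseteq> X" using U X by (auto simp: openin_zariski_iff)
    let ?W = "U \<inter> nonvanishing X G"
    have "openin (zariski X) ?W" using U openin_nonvanishing[OF X F(2)] by blast
    moreover have "P \<in> ?W" using P UX F by (auto simp: nonvanishing_def)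
    moreover have "\<forall>L\<in>?W. \<forall>v\<in>L - {0}. G v \<noteq> 0 \<and> f L = F v / G v"
      using eq by (auto simp: nonvanishing_def field_simps)
    ultimately show "\<exists>W d F G. openin (zariski X) W \<and> P \<in> W \<and> W \<subseteq> U \<and> form d F \<and> form d G \<and>
        (\<forall>L\<in>W. \<forall>v\<in>L - {0}. G v \<noteq> 0 \<and> f L = F v / G v)"
      using F by (intro exI[of _ ?W] exI[of _ d] exI[of _ F] exI[of _ G] conjI) simp_all
  qed
qed

lemma regular_on_cong:
  assumes "\<And>L. L \<in> U \<Longrightarrow> f L = g L"
  shows "regular_on X U f \<longleftrightarrow> regular_on X U g"
proof -
  have "regular_on X U g" if "regular_on X U f" "\<And>L. L \<in> U \<Longrightarrow> f L = g L" for f g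
    unfolding regular_on_def
  proof
    fix P assume "P \<in> U"
    from bspec[OF that(1)[unfolded regular_on_def] this]
    obtain W d F G where W: "openin (zariski X) W" "P \<in> W" "W \<subseteq> U"
      "form d F" "form d G" "\<forall>L\<in>W. \<forall>v\<in>L - {0}. G v \<noteq> 0 \<and> f L = F v / G v"
      by (elim exE conjE) (rule that)
    moreover have "\<forall>L\<in>W. \<forall>v\<in>L - {0}. G v \<noteq> 0 \<and> g L = F v / G v"
    proof (intro ballI)
      fix L v assume "L \<in> W" "v \<in> L - {0}"
      then show "G v \<noteq> 0 \<and> g L = F v / G v"
        using W(6) that(2)[of L] W(3) by auto
    qed
    ultimately show "\<exists>W d F G. openin (zariski X) W \<and> P \<in> W \<and> W \<subseteq> U \<and> form d F \<and> form d G \<and>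
        (\<forall>L\<in>W. \<forall>v\<in>L - {0}. G v \<noteq> 0 \<and> g L = F v / G v)"
      by (intro exI[of _ W] exI[of _ d] exI[of _ F] exI[of _ G] conjI) simp_all
  qed
  from this[of f g] this[of g f] show ?thesis using assms by auto
qed

definition proj_map :: "(complex ^ 'n \<Rightarrow> complex ^ 'm) \<Rightarrow> (complex ^ 'n) set \<Rightarrow> (complex ^ 'm) set"
  where "proj_map P L = vec.span (P ` L)"

lemma forms_scale:
  fixes P :: "complex ^ 'n \<Rightarrow> complex ^ 'm"
  assumes "\<And>i. form e (\<lambda>v. P v $ i)"
  shows "P (c *s v) = c ^ e *s P v"
  by (simp add: vec_eq_iff form_scale[OF assms])

lemma proj_map_line:
  fixes P :: "complex ^ 'n \<Rightarrow> complex ^ 'm"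
  assumes "\<And>i. form e (\<lambda>v. P v $ i)"
  shows "proj_map P (vec.span {v}) = vec.span {P v}"
proof -
  have "P ` vec.span {v} \<subseteq> vec.span {P v}"
    by (auto simp: span_line forms_scale[OF assms])
  moreover have "{P v} \<subseteq> vec.span (P ` vec.span {v})"
    by (auto intro: vec.span_base)
  ultimately show ?thesis
    unfolding proj_map_def by (intro vec.span_eq[THEN iffD2]) auto
qed

text \<open>
  Forms of one common degree without common zeros on \<open>X\<close> define a morphism: composing with them
  turns the form that cuts out a basic open set, or the two forms of a fraction, into forms again.
\<close>

lemma morphism_by_forms:
  fixes P :: "complex ^ 'n \<Rightarrow> complex ^ 'm"
  assumes X: "X \<subseteq> proj_space" and Y: "Y \<subseteq> proj_space"
    and P: "\<And>i. form e (\<lambda>v. P v $ i)"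
    and PX: "\<And>v. v \<noteq> 0 \<Longrightarrow> vec.span {v} \<in> X \<Longrightarrow> P v \<noteq> 0 \<and> vec.span {P v} \<in> Y"
  shows "morphism (variety X) (variety Y) (proj_map P)"
proof -
  have map: "P v \<noteq> 0" "proj_map P L = vec.span {P v}" "proj_map P L \<in> Y" "P v \<in> proj_map P L - {0}"
    if "L \<in> X" "v \<in> L - {0}" for L v
  proof -
    have L: "L = vec.span {v}" using proj_space_line X that by blast
    then show "proj_map P L = vec.span {P v}" using proj_map_line[OF P] by simp
    then show "P v \<noteq> 0" "proj_map P L \<in> Y" "P v \<in> proj_map P L - {0}"
      using PX[of v] L that by (auto intro: vec.span_base)
  qed
  have nz: "\<exists>v. v \<in> L - {0}" if "L \<in> X" for L
  proof -
    obtain v where "v \<noteq> 0" "L = vec.span {v}" using \<open>L \<in> X\<close> X proj_spaceE by blast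
    then have "v \<in> L - {0}" using vec.span_base[of v "{v}"] by simp
    then show ?thesis ..
  qed
  have inY: "proj_map P L \<in> Y" if "L \<in> X" for L
    using map(3) nz that by blast
  have op: "openin (zariski X) {L \<in> X. proj_map P L \<in> V}" if V: "openin (zariski Y) V" for V
    unfolding openin_zariski_iff[OF X]
  proof (intro conjI ballI)
    fix L assume "L \<in> {L \<in> X. proj_map P L \<in> V}"
    then have L: "L \<in> X" "proj_map P L \<in> V" by auto
    with V obtain d F where F: "form d F" "proj_map P L \<in> nonvanishing Y F" "nonvanishing Y F \<subseteq> V"
      unfolding openin_zariski_iff[OF Y] by blast
    have iff: "proj_map P L \<in> nonvanishing Y F \<longleftrightarrow> L \<in> nonvanishing X (\<lambda>v. F (P v))"
      if L: "L \<in> X" for L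
    proof -
      obtain v where v: "v \<in> L - {0}" using nz[OF L] by blast
      then have eq: "L = vec.span {v}" using proj_space_line X L by blast
      show ?thesis
        using map[OF L v] v L eq line_in_nonvanishing[OF F(1), of "P v" Y]
          line_in_nonvanishing[OF form_compose[OF P F(1)], of v X] by auto
    qed
    show "\<exists>d F. form d F \<and> L \<in> nonvanishing X F \<and> nonvanishing X F \<subseteq> {L \<in> X. proj_map P L \<in> V}"
    proof (intro exI conjI)
      show "form (d * e) (\<lambda>v. F (P v))" by (rule form_compose[OF P F(1)])
      show "L \<in> nonvanishing X (\<lambda>v. F (P v))" using iff L F by blast
      show "nonvanishing X (\<lambda>v. F (P v)) \<subseteq> {L \<in> X. proj_map P L \<in> V}"
      proof
        fix M assume M: "M \<in> nonvanishing X (\<lambda>v. F (P v))"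
        then have "M \<in> X" by (simp add: nonvanishing_def)
        then show "M \<in> {L \<in> X. proj_map P L \<in> V}" using M iff F(3) by blast
      qed
    qed
  qed auto
  have reg: "regular_on X {L \<in> X. proj_map P L \<in> V} (f \<circ> proj_map P)"
    if V: "openin (zariski Y) V" and f: "regular_on Y V f" for V f
    unfolding regular_on_iff[OF X op[OF V]]
  proof
    fix L assume "L \<in> {L \<in> X. proj_map P L \<in> V}"
    then have L: "L \<in> X" "proj_map P L \<in> V" by auto
    from bspec[OF iffD1[OF regular_on_iff[OF Y V] f] L(2)]
    obtain d F G where F: "form d F" "form d G" "\<forall>v\<in>proj_map P L - {0}. G v \<noteq> 0"
      "\<forall>M\<in>V. \<forall>v\<in>M - {0}. f M * G v = F v"
      by (elim exE conjE) (rule that)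
    show "\<exists>d F G. form d F \<and> form d G \<and> (\<forall>v\<in>L - {0}. G v \<noteq> 0) \<and>
      (\<forall>L\<in>{L \<in> X. proj_map P L \<in> V}. \<forall>v\<in>L - {0}. (f \<circ> proj_map P) L * G v = F v)"
    proof (intro exI conjI ballI)
      show "form (d * e) (\<lambda>v. F (P v))" "form (d * e) (\<lambda>v. G (P v))"
        by (rule form_compose[OF P F(1)], rule form_compose[OF P F(2)])
      show "G (P v) \<noteq> 0" if "v \<in> L - {0}" for v
        using F(3) map(4)[OF L(1) that] by blast
      show "(f \<circ> proj_map P) M * G (P v) = F (P v)"
        if "M \<in> {L \<in> X. proj_map P L \<in> V}" "v \<in> M - {0}" for M v
        using that F(4) map(4)[of M v] by simp
    qed
  qed
  show ?thesis
    unfolding morphism_def continuous_map_def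
    using topspace_zariski[OF X] topspace_zariski[OF Y] inY op reg
    by (simp add: variety_def)
qed

text \<open>
  A quotient by a group is determined by the fibres of the projection together with the two ways in
  which the target inherits its structure from the source: images of saturated open sets
  are open, and a function is regular as soon as its pullback is.
\<close>

lemma quotient_isomorphic:
  assumes X: "X \<subseteq> proj_space" and Y: "Y \<subseteq> proj_space"
    and mor: "morphism (variety X) (variety Y) \<pi>" and onto: "\<pi> ` X = Y"
    and fibre: "\<And>L. L \<in> X \<Longrightarrow> orbit G \<phi> L = {L' \<in> X. \<pi> L' = \<pi> L}"
    and op: "\<And>V. V \<subseteq> Y \<Longrightarrow> openin (zariski X) {L \<in> X. \<pi> L \<in> V} \<Longrightarrow> openin (zariski Y) V"
    and reg: "\<And>V f. openin (zariski Y) V \<Longrightarrow> regular_on X {L \<in> X. \<pi> L \<in> V} (f \<circ> \<pi>) \<Longrightarrow> regular_on Y V f"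
  shows "isomorphic (quotient_space (variety X) G \<phi>) (variety Y)"
proof -
  define h where "h A = the_elem (\<pi> ` A)" for A
  define k where "k Q = {L \<in> X. \<pi> L = Q}" for Q
  have h: "h (orbit G \<phi> L) = \<pi> L" if "L \<in> X" for L
  proof -
    have "\<pi> ` orbit G \<phi> L = {\<pi> L}" using that by (auto simp: fibre)
    then show ?thesis by (simp add: h_def)
  qed
  have k: "k (\<pi> L) = orbit G \<phi> L" if "L \<in> X" for L
    using that by (simp add: k_def fibre)
  have tX: "topspace (fspace_top (variety X)) = X" and tY: "topspace (fspace_top (variety Y)) = Y"
    by (simp_all add: variety_def topspace_zariski X Y)
  let ?Q = "quotient_space (variety X) G \<phi>"
  have tQ: "topspace (fspace_top ?Q) = orbit G \<phi> ` X"
    by (simp add: quotient_space_def topspace_quotient_topology tX)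
  have oQ: "openin (fspace_top ?Q) U \<longleftrightarrow> U \<subseteq> orbit G \<phi> ` X \<and> openin (zariski X) {L \<in> X. orbit G \<phi> L \<in> U}" for U
    using tX by (simp add: quotient_space_def openin_quotient_topology variety_def)
  have rQ: "f \<in> regular ?Q U \<longleftrightarrow> regular_on X {L \<in> X. orbit G \<phi> L \<in> U} (f \<circ> orbit G \<phi>)" for f U
    using tX by (simp add: quotient_space_def variety_def)
  have pre: "openin (zariski X) {L \<in> X. \<pi> L \<in> V}" if "openin (zariski Y) V" for V
    using mor that tX by (simp add: morphism_def continuous_map_def variety_def topspace_zariski X)
  have preh: "{L \<in> X. orbit G \<phi> L \<in> {A \<in> orbit G \<phi> ` X. h A \<in> V}} = {L \<in> X. \<pi> L \<in> V}" for V
    using h by auto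
  have prek: "{L \<in> X. \<pi> L \<in> {Q \<in> Y. k Q \<in> U}} = {L \<in> X. orbit G \<phi> L \<in> U}" for U
    using k onto by auto
  have "morphism ?Q (variety Y) h"
    unfolding morphism_def continuous_map_def tQ tY oQ rQ preh
  proof (intro conjI allI impI)
    show "h \<in> orbit G \<phi> ` X \<rightarrow> Y" using h onto by auto
    fix V assume "openin (fspace_top (variety Y)) V"
    then show "openin (zariski X) {L \<in> X. \<pi> L \<in> V}" using pre by (simp add: variety_def)
  next
    fix V f assume a: "openin (fspace_top (variety Y)) V \<and> f \<in> regular (variety Y) V"
    then have "f \<circ> \<pi> \<in> regular (variety X) {L \<in> X. \<pi> L \<in> V}"
      using mor unfolding morphism_def tX by blast
    then have "regular_on X {L \<in> X. \<pi> L \<in> V} (f \<circ> \<pi>)" by (simp add: variety_def)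
    then show "regular_on X {L \<in> X. \<pi> L \<in> V} (f \<circ> h \<circ> orbit G \<phi>)"
      by (rule iffD1[OF regular_on_cong, rotated]) (simp add: h)
  qed auto
  moreover have "morphism (variety Y) ?Q k"
    unfolding morphism_def continuous_map_def tQ tY oQ rQ
  proof (intro conjI allI impI)
    show "k \<in> Y \<rightarrow> orbit G \<phi> ` X" using k onto by auto
  next
    fix U assume "U \<subseteq> orbit G \<phi> ` X \<and> openin (zariski X) {L \<in> X. orbit G \<phi> L \<in> U}"
    then show "openin (fspace_top (variety Y)) {Q \<in> Y. k Q \<in> U}"
      using op[of "{Q \<in> Y. k Q \<in> U}"] unfolding prek by (simp add: variety_def)
  next
    fix U f
    assume a: "(U \<subseteq> orbit G \<phi> ` X \<and> openin (zariski X) {L \<in> X. orbit G \<phi> L \<in> U}) \<and>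
       regular_on X {L \<in> X. orbit G \<phi> L \<in> U} (f \<circ> orbit G \<phi>)"
    have "openin (zariski Y) {Q \<in> Y. k Q \<in> U}"
      using a op[of "{Q \<in> Y. k Q \<in> U}"] unfolding prek by auto
    moreover have "regular_on X {L \<in> X. \<pi> L \<in> {Q \<in> Y. k Q \<in> U}} (f \<circ> k \<circ> \<pi>)"
      unfolding prek
      by (rule iffD1[OF regular_on_cong, OF _ conjunct2[OF a]]) (simp add: k)
    ultimately show "f \<circ> k \<in> regular (variety Y) {Q \<in> Y. k Q \<in> U}"
      using reg by (simp add: variety_def)
  qed
  moreover have "\<forall>A\<in>topspace (fspace_top ?Q). k (h A) = A"
    unfolding tQ using h k by auto
  moreover have "\<forall>Q\<in>topspace (fspace_top (variety Y)). h (k Q) = Q"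
    unfolding tY using h k onto by auto
  ultimately show ?thesis
    unfolding isomorphic_def by blast
qed

section \<open>Weighted forms\<close>

text \<open>
  Defined as sums of monomials rather than by closure under products, so that induction meets only
  monomials and sums. All weights 1 give the ordinary forms, weights 1, 2, 3 the polynomials in
  the invariants of the group.
\<close>

inductive weighted_form :: "('n::finite \<Rightarrow> nat) \<Rightarrow> nat \<Rightarrow> (complex ^ 'n \<Rightarrow> complex) \<Rightarrow> bool"
  for w where
  weighted_monomial:
    "d = (\<Sum>i\<in>UNIV. w i * m i) \<Longrightarrow> weighted_form w d (\<lambda>v. c * (\<Prod>i\<in>UNIV. v $ i ^ m i))"
| weighted_add: "weighted_form w d F \<Longrightarrow> weighted_form w d G \<Longrightarrow> weighted_form w d (\<lambda>v. F v + G v)"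

lemma weighted_mult:
  assumes "weighted_form w d F" "weighted_form w e G"
  shows "weighted_form w (d + e) (\<lambda>v. F v * G v)"
  using assms(1)
proof (induction rule: weighted_form.induct)
  case (weighted_monomial d m c)
  from assms(2) show ?case
  proof (induction rule: weighted_form.induct)
    case (weighted_monomial e m' c')
    have "weighted_form w (d + e) (\<lambda>v. (c * c') * (\<Prod>i\<in>UNIV. v $ i ^ (m i + m' i)))"
      using \<open>d = _\<close> \<open>e = _\<close>
      by (intro weighted_form.weighted_monomial) (simp add: sum.distrib distrib_left)
    then show ?case by (simp add: power_add prod.distrib mult_ac)
  next
    case (weighted_add e F G)
    then show ?case using weighted_form.weighted_add by (fastforce simp: distrib_left)
  qed
next
  case (weighted_add d F G)
  then show ?case using weighted_form.weighted_add by (fastforce simp: distrib_right)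
qed

lemma weighted_const: "weighted_form w 0 (\<lambda>v. c)"
  using weighted_monomial[of 0 w "\<lambda>_. 0" c] by simp

lemma weighted_coord: "weighted_form w (w i) (\<lambda>v. v $ i)"
proof -
  have "v $ j ^ (if j = i then 1 else 0) = (if j = i then v $ j else 1)" for v :: "complex ^ 'a" and j
    by simp
  moreover have "w i = (\<Sum>j\<in>UNIV. w j * (if j = i then 1 else 0))" by (simp add: mult_delta_right)
  ultimately show ?thesis
    using weighted_monomial[of "w i" w "\<lambda>j. if j = i then 1 else 0" 1] by simp
qed

lemma form_imp_weighted: "form d F \<Longrightarrow> weighted_form (\<lambda>_. 1) d F"
proof (induction rule: form.induct)
  case (form_coord i)
  show ?case by (rule weighted_coord)
qed (auto intro: weighted_const weighted_add weighted_mult)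


section \<open>Invariants on Bring's curve\<close>

lemma exhaust_5:
  fixes x :: 5
  shows "x = 1 \<or> x = 2 \<or> x = 3 \<or> x = 4 \<or> x = 5"
proof (induct x)
  case (of_int z)
  then have "z = 0 \<or> z = 1 \<or> z = 2 \<or> z = 3 \<or> z = 4" by fastforce
  then show ?case by auto
qed

lemma forall_5: "(\<forall>i::5. P i) \<longleftrightarrow> P 1 \<and> P 2 \<and> P 3 \<and> P 4 \<and> P 5"
  by (metis exhaust_5)

lemma UNIV_5: "UNIV = {1, 2, 3, 4, 5::5}"
  using exhaust_5 by auto

lemma sum_5: "sum f (UNIV::5 set) = f 1 + f 2 + f 3 + f 4 + f 5"
  unfolding UNIV_5 by (simp add: ac_simps)

lemma prod_5: "prod f (UNIV::5 set) = f 1 * f 2 * f 3 * f 4 * f 5"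
  unfolding UNIV_5 by (simp add: ac_simps)

lemma prod_3: "prod f (UNIV::3 set) = f 1 * f 2 * f 3"
  unfolding UNIV_3 by (simp add: ac_simps)

definition bring_cone :: "(complex ^ 5) set" where
  "bring_cone = {x. (\<Sum>i\<in>UNIV. x $ i) = 0 \<and> (\<Sum>i\<in>UNIV. (x $ i)\<^sup>2) = 0 \<and> (\<Sum>i\<in>UNIV. (x $ i) ^ 3) = 0}"

text \<open>
  The invariants of \<open>x\<^sub>1, x\<^sub>2\<close> under the transposition are generated by the two elementary symmetric
  functions, those of \<open>x\<^sub>3, x\<^sub>4, x\<^sub>5\<close> under the 3-cycle by the three elementary symmetric functions and
  the square root of the discriminant. On Bring's curve only the following three remain.
\<close>

definition invariants :: "complex ^ 5 \<Rightarrow> complex ^ 3" where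
  "invariants v =
     vector [v $ 1 + v $ 2, v $ 1 * v $ 2, (v $ 3 - v $ 4) * (v $ 4 - v $ 5) * (v $ 5 - v $ 3)]"

definition invariant_degree :: "3 \<Rightarrow> nat" where
  "invariant_degree i = (if i = 1 then 1 else if i = 2 then 2 else 3)"

text \<open>
  The cone over the quotient, embedded in the weighted projective plane with weights 1, 2, 3: the
  square of the third invariant is the discriminant of \<open>(t - x\<^sub>3) (t - x\<^sub>4) (t - x\<^sub>5)\<close>, expressed by
  the other two.
\<close>

definition discriminant_curve :: "(complex ^ 3) set" where
  "discriminant_curve = {u. (u $ 3)\<^sup>2 =
     4 * (u $ 2) ^ 3 - 83 * (u $ 1)\<^sup>2 * (u $ 2)\<^sup>2 + 72 * (u $ 1) ^ 4 * u $ 2 - 16 * (u $ 1) ^ 6}"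

text \<open>
  Newton's identities: the three equations of the curve determine the elementary symmetric
  functions of \<open>x\<^sub>3, x\<^sub>4, x\<^sub>5\<close> from those of \<open>x\<^sub>1, x\<^sub>2\<close>.
\<close>

lemma bring_cone_iff:
  "v \<in> bring_cone \<longleftrightarrow> (let s = v $ 1 + v $ 2; p = v $ 1 * v $ 2 in
     v $ 3 + v $ 4 + v $ 5 = - s \<and>
     v $ 3 * v $ 4 + v $ 4 * v $ 5 + v $ 5 * v $ 3 = s\<^sup>2 - p \<and>
     v $ 3 * v $ 4 * v $ 5 = 2 * s * p - s ^ 3)"
proof -
  have newton: "a + b + c + d + e = 0 \<and> a\<^sup>2 + b\<^sup>2 + c\<^sup>2 + d\<^sup>2 + e\<^sup>2 = 0 \<and> a ^ 3 + b ^ 3 + c ^ 3 + d ^ 3 + e ^ 3 = 0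
    \<longleftrightarrow> c + d + e = - (a + b) \<and> c * d + d * e + e * c = (a + b)\<^sup>2 - a * b \<and>
       c * d * e = 2 * (a + b) * (a * b) - (a + b) ^ 3" (is "?l \<longleftrightarrow> ?r")
    for a b c d e :: complex
  proof
    assume l: ?l
    have 1: "c + d + e = - (a + b)" using l by algebra
    have "2 * (c * d + d * e + e * c) = 2 * ((a + b)\<^sup>2 - a * b)"
      using l 1 by algebra
    then have 2: "c * d + d * e + e * c = (a + b)\<^sup>2 - a * b"
      by (simp only: mult_cancel_left) simp
    have "c ^ 3 + d ^ 3 + e ^ 3 = (c + d + e) ^ 3 - 3 * (c + d + e) * (c * d + d * e + e * c) + 3 * (c * d * e)"
      by algebra
    then have "3 * (c * d * e) = 3 * (2 * (a + b) * (a * b) - (a + b) ^ 3)"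
      using l 1 2 by algebra
    then have "c * d * e = 2 * (a + b) * (a * b) - (a + b) ^ 3"
      by (simp only: mult_cancel_left) simp
    with 1 2 show ?r by simp
  next
    assume r: ?r
    have "c\<^sup>2 + d\<^sup>2 + e\<^sup>2 = (c + d + e)\<^sup>2 - 2 * (c * d + d * e + e * c)"
      "c ^ 3 + d ^ 3 + e ^ 3 = (c + d + e) ^ 3 - 3 * (c + d + e) * (c * d + d * e + e * c) + 3 * (c * d * e)"
      by algebra+
    with r show ?l by algebra
  qed
  show ?thesis
    unfolding bring_cone_def Let_def by (simp only: mem_Collect_eq sum_5 newton)
qed

lemma cubic_discriminant:
  fixes x y z :: complex
  assumes "x + y + z = a" "x * y + y * z + z * x = b" "x * y * z = c"
  shows "((x - y) * (y - z) * (z - x))\<^sup>2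
    = a\<^sup>2 * b\<^sup>2 - 4 * b ^ 3 - 4 * a ^ 3 * c - 27 * c\<^sup>2 + 18 * a * b * c"
  unfolding assms[symmetric] by algebra

lemma discriminant_curve_identity:
  fixes s p :: complex
  shows "(- s)\<^sup>2 * (s\<^sup>2 - p)\<^sup>2 - 4 * (s\<^sup>2 - p) ^ 3 - 4 * (- s) ^ 3 * (2 * s * p - s ^ 3)
    - 27 * (2 * s * p - s ^ 3)\<^sup>2 + 18 * (- s) * (s\<^sup>2 - p) * (2 * s * p - s ^ 3)
    = 4 * p ^ 3 - 83 * s\<^sup>2 * p\<^sup>2 + 72 * s ^ 4 * p - 16 * s ^ 6"
  by algebra

lemma invariants_in_discriminant_curve:
  assumes "v \<in> bring_cone"
  shows "invariants v \<in> discriminant_curve"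
  using cubic_discriminant[of "v $ 3" "v $ 4" "v $ 5"] assms
    discriminant_curve_identity[of "v $ 1 + v $ 2" "v $ 1 * v $ 2"]
  by (simp add: bring_cone_iff Let_def discriminant_curve_def invariants_def)

definition descends :: "nat \<Rightarrow> (complex ^ 5 \<Rightarrow> complex) \<Rightarrow> bool" where
  "descends d F \<longleftrightarrow>
     (\<exists>Q. weighted_form invariant_degree d Q \<and> (\<forall>v\<in>bring_cone. F v = Q (invariants v)))"

lemma descends_cong:
  "descends d F \<Longrightarrow> (\<And>v. v \<in> bring_cone \<Longrightarrow> F v = G v) \<Longrightarrow> descends d G"
  unfolding descends_def by metis

lemma descends_add:
  assumes "descends d F" "descends d G"
  shows "descends d (\<lambda>v. F v + G v)"
proof -
  obtain Q R where "weighted_form invariant_degree d Q" "\<forall>v\<in>bring_cone. F v = Q (invariants v)"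
    "weighted_form invariant_degree d R" "\<forall>v\<in>bring_cone. G v = R (invariants v)"
    using assms unfolding descends_def by blast
  then show ?thesis
    unfolding descends_def by (intro exI[of _ "\<lambda>u. Q u + R u"]) (simp add: weighted_add)
qed

lemma descends_mult:
  assumes "descends d F" "descends e G" "n = d + e"
  shows "descends n (\<lambda>v. F v * G v)"
proof -
  obtain Q R where "weighted_form invariant_degree d Q" "\<forall>v\<in>bring_cone. F v = Q (invariants v)"
    "weighted_form invariant_degree e R" "\<forall>v\<in>bring_cone. G v = R (invariants v)"
    using assms unfolding descends_def by blast
  then show ?thesis
    unfolding descends_def assms(3)
    by (intro exI[of _ "\<lambda>u. Q u * R u"]) (simp add: weighted_mult)
qed

lemma descends_const: "descends 0 (\<lambda>v. c)"
  unfolding descends_def using weighted_const by blast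

lemma descends_smult: "descends d F \<Longrightarrow> descends d (\<lambda>v. c * F v)"
  by (rule descends_mult[OF descends_const]) auto

lemma descends_diff: "descends d F \<Longrightarrow> descends d G \<Longrightarrow> descends d (\<lambda>v. F v - G v)"
  using descends_add[OF _ descends_smult[of d G "-1"]] by simp

lemma descends_coord:
  "descends 1 (\<lambda>v. v $ 1 + v $ 2)" "descends 2 (\<lambda>v. v $ 1 * v $ 2)"
  "descends 3 (\<lambda>v. (v $ 3 - v $ 4) * (v $ 4 - v $ 5) * (v $ 5 - v $ 3))"
proof -
  have "descends (invariant_degree i) (\<lambda>v. invariants v $ i)" for i
    unfolding descends_def using weighted_coord by blast
  from this[of 1] this[of 2] this[of 3]
  show "descends 1 (\<lambda>v. v $ 1 + v $ 2)" "descends 2 (\<lambda>v. v $ 1 * v $ 2)"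
    "descends 3 (\<lambda>v. (v $ 3 - v $ 4) * (v $ 4 - v $ 5) * (v $ 5 - v $ 3))"
    by (simp_all add: invariants_def invariant_degree_def)
qed

lemma descends_elementary:
  "descends 1 (\<lambda>v. v $ 3 + v $ 4 + v $ 5)"
  "descends 2 (\<lambda>v. v $ 3 * v $ 4 + v $ 4 * v $ 5 + v $ 5 * v $ 3)"
  "descends 3 (\<lambda>v. v $ 3 * v $ 4 * v $ 5)"
proof -
  let ?s = "\<lambda>v :: complex ^ 5. v $ 1 + v $ 2" and ?p = "\<lambda>v :: complex ^ 5. v $ 1 * v $ 2"
  have s2: "descends 2 (\<lambda>v. ?s v * ?s v)" by (rule descends_mult[OF descends_coord(1,1)]) simp
  have "descends 1 (\<lambda>v. (-1) * ?s v)" by (rule descends_smult[OF descends_coord(1)])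
  then show "descends 1 (\<lambda>v. v $ 3 + v $ 4 + v $ 5)"
    by (rule descends_cong) (simp add: bring_cone_iff Let_def)
  have "descends 2 (\<lambda>v. ?s v * ?s v - ?p v)" by (rule descends_diff[OF s2 descends_coord(2)])
  then show "descends 2 (\<lambda>v. v $ 3 * v $ 4 + v $ 4 * v $ 5 + v $ 5 * v $ 3)"
    by (rule descends_cong) (simp add: bring_cone_iff Let_def power2_eq_square)
  have "descends 3 (\<lambda>v. ?s v * (2 * ?p v - ?s v * ?s v))"
    by (rule descends_mult[OF descends_coord(1) descends_diff[OF descends_smult[OF descends_coord(2)] s2]]) simp
  then show "descends 3 (\<lambda>v. v $ 3 * v $ 4 * v $ 5)"
    by (rule descends_cong)
      (simp add: bring_cone_iff Let_def power2_eq_square power3_eq_cube right_diff_distrib mult_ac)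
qed

lemma two_step_induct:
  "P a" if "P 0" "P 1" "\<And>a. P a \<Longrightarrow> P (a + 1) \<Longrightarrow> P (a + 2)" for a :: nat
proof -
  have "P a \<and> P (a + 1)" using that by (induction a) auto
  then show ?thesis ..
qed

lemma three_step_induct:
  "P a" if "P 0" "P 1" "P 2" "\<And>a. P a \<Longrightarrow> P (a + 1) \<Longrightarrow> P (a + 2) \<Longrightarrow> P (a + 3)" for a :: nat
proof -
  have "P a \<and> P (a + 1) \<and> P (a + 2)"
    using that by (induction a) (auto simp: numeral_2_eq_2 numeral_3_eq_3)
  then show ?thesis ..
qed

text \<open>
  Both variables are roots of \<open>t\<^sup>2 - (x\<^sub>1 + x\<^sub>2) t + x\<^sub>1 x\<^sub>2\<close>, which lowers exponents above 1.
\<close>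

lemma descends_swap_sum:
  "descends (a + b) (\<lambda>v. v $ 1 ^ a * v $ 2 ^ b + v $ 2 ^ a * v $ 1 ^ b)"
proof -
  let ?f = "\<lambda>a b (v :: complex ^ 5). v $ 1 ^ a * v $ 2 ^ b + v $ 2 ^ a * v $ 1 ^ b"
  let ?s = "\<lambda>v :: complex ^ 5. v $ 1 + v $ 2" and ?p = "\<lambda>v :: complex ^ 5. v $ 1 * v $ 2"
  have sym: "descends (b + a) (?f b a)" if "descends (a + b) (?f a b)" for a b
    using that by (simp add: ac_simps)
  have step: "descends (a + 2 + b) (?f (a + 2) b)"
    if "descends (a + b) (?f a b)" "descends (a + 1 + b) (?f (a + 1) b)" for a b
  proof -
    have "descends (a + 2 + b) (\<lambda>v. ?s v * ?f (a + 1) b v - ?p v * ?f a b v)"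
      by (intro descends_diff descends_mult[OF descends_coord(1) that(2)]
          descends_mult[OF descends_coord(2) that(1)]) simp_all
    then show ?thesis by (rule descends_cong) (simp add: algebra_simps power2_eq_square)
  qed
  have base0: "descends (a + 0) (?f a 0)" for a
  proof (induction a rule: two_step_induct)
    case 1
    show ?case using descends_const[of 2] by simp
  next
    case 2
    show ?case using descends_coord(1) by simp
  qed (rule step)
  have base1: "descends (a + 1) (?f a 1)" for a
  proof (induction a rule: two_step_induct)
    case 1
    show ?case using sym[OF base0[of 1]] by simp
  next
    case 2
    show ?case using descends_smult[OF descends_coord(2), of 2] by (simp add: mult_ac numeral_2_eq_2)
  qed (rule step)
  have "descends (b + a) (?f b a)"
    by (induction b rule: two_step_induct) (use sym[OF base0] sym[OF base1] step in auto)
  then show ?thesis by (rule sym)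
qed

text \<open>
  Each variable is a root of \<open>t\<^sup>3 - e\<^sub>1 t\<^sup>2 + e\<^sub>2 t - e\<^sub>3\<close>, so exponents reduce to at most 2. Among the
  remaining cyclic sums only \<open>x\<^sup>2 y + y\<^sup>2 z + z\<^sup>2 x\<close> and its mirror image are not symmetric; they
  differ by the discriminant root.
\<close>

lemma descends_cyclic_sum:
  "descends (a + b + c) (\<lambda>v. v $ 3 ^ a * v $ 4 ^ b * v $ 5 ^ c +
     v $ 4 ^ a * v $ 5 ^ b * v $ 3 ^ c + v $ 5 ^ a * v $ 3 ^ b * v $ 4 ^ c)"
proof -
  let ?x = "\<lambda>v :: complex ^ 5. v $ 3"
  let ?y = "\<lambda>v :: complex ^ 5. v $ 4"
  let ?z = "\<lambda>v :: complex ^ 5. v $ 5"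
  define e1 e2 e3 where "e1 v = ?x v + ?y v + ?z v"
    and "e2 v = ?x v * ?y v + ?y v * ?z v + ?z v * ?x v"
    and "e3 v = ?x v * ?y v * ?z v" for v
  define \<delta> where "\<delta> v = (?x v - ?y v) * (?y v - ?z v) * (?z v - ?x v)" for v
  have e: "descends 1 e1" "descends 2 e2" "descends 3 e3" "descends 3 \<delta>"
    unfolding e1_def e2_def e3_def \<delta>_def using descends_elementary descends_coord(3) by blast+
  define f where "f a b c v = ?x v ^ a * ?y v ^ b * ?z v ^ c + ?y v ^ a * ?z v ^ b * ?x v ^ c +
    ?z v ^ a * ?x v ^ b * ?y v ^ c" for a b c v
  have rot: "descends (a + b + c) (f a b c)" if "descends (b + c + a) (f b c a)" for a b c
  proof -
    have "f b c a = f a b c" by (simp add: f_def fun_eq_iff mult_ac)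
    with that show ?thesis by (simp add: add_ac)
  qed
  have step: "descends (a + 3 + b + c) (f (a + 3) b c)"
    if "descends (a + b + c) (f a b c)" "descends (a + 1 + b + c) (f (a + 1) b c)"
      "descends (a + 2 + b + c) (f (a + 2) b c)" for a b c
  proof -
    have root: "t ^ (a + 3) = e1 v * t ^ (a + 2) - e2 v * t ^ (a + 1) + e3 v * t ^ a"
      if "t = ?x v \<or> t = ?y v \<or> t = ?z v" for t v
    proof -
      have "(t - ?x v) * (t - ?y v) * (t - ?z v) = t ^ 3 - (e1 v * t\<^sup>2 - e2 v * t + e3 v)"
        unfolding e1_def e2_def e3_def by algebra
      moreover have "(t - ?x v) * (t - ?y v) * (t - ?z v) = 0" using that by auto
      ultimately have "t ^ 3 = e1 v * t\<^sup>2 - e2 v * t + e3 v" by simp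
      then have "t ^ a * t ^ 3 = t ^ a * (e1 v * t\<^sup>2 - e2 v * t + e3 v)" by simp
      then show ?thesis by (simp only: power_add) (simp add: algebra_simps)
    qed
    have D: "descends (a + 3 + b + c) (\<lambda>v. e1 v * f (a + 2) b c v - e2 v * f (a + 1) b c v + e3 v * f a b c v)"
      by (intro descends_add descends_diff descends_mult[OF e(1) that(3)]
          descends_mult[OF e(2) that(2)] descends_mult[OF e(3) that(1)]) simp_all
    have E: "f (a + 3) b c v = e1 v * f (a + 2) b c v - e2 v * f (a + 1) b c v + e3 v * f a b c v" for v
    proof -
      have "?x v ^ (a + 3) = e1 v * ?x v ^ (a + 2) - e2 v * ?x v ^ (a + 1) + e3 v * ?x v ^ a"
        "?y v ^ (a + 3) = e1 v * ?y v ^ (a + 2) - e2 v * ?y v ^ (a + 1) + e3 v * ?y v ^ a"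
        "?z v ^ (a + 3) = e1 v * ?z v ^ (a + 2) - e2 v * ?z v ^ (a + 1) + e3 v * ?z v ^ a"
        by (rule root, blast)+
      then show ?thesis unfolding f_def by (simp only:) (simp only: algebra_simps)
    qed
    show ?thesis by (rule descends_cong[OF D]) (rule E[symmetric])
  qed
  \<comment> \<open>The recurrence lowers the first exponent only; rotating the triple brings the others to the front.\<close>
  have reduce: "descends (a + b + c) (f a b c)"
    if "\<And>a. a \<in> {0, 1, 2} \<Longrightarrow> descends (a + b + c) (f a b c)" for a b c
  proof (induction a rule: three_step_induct)
    case 4
    then show ?case by (rule step)
  qed (rule that, simp)+
  have e11: "descends 2 (\<lambda>v. e1 v * e1 v)" and e12: "descends 3 (\<lambda>v. e1 v * e2 v)"
    and e22: "descends 4 (\<lambda>v. e2 v * e2 v)" and e13: "descends 4 (\<lambda>v. e1 v * e3 v)"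
    by (rule descends_mult[OF e(1) e(1)] descends_mult[OF e(1) e(2)]
        descends_mult[OF e(2) e(2)] descends_mult[OF e(1) e(3)], simp)+
  have e112: "descends 2 (\<lambda>v. e1 v * e1 v - 2 * e2 v)"
    by (intro descends_diff e11 descends_smult e)
  have d00: "descends 0 (f 0 0 0)"
    by (rule descends_cong[OF descends_const[of 3]]) (simp add: f_def)
  have d10: "descends 1 (f 1 0 0)" "descends 1 (f 0 1 0)"
    by (rule descends_cong[OF e(1)], simp add: f_def e1_def add_ac)+
  have d20: "descends 2 (f 2 0 0)" "descends 2 (f 0 2 0)"
    by (rule descends_cong[OF e112], simp add: f_def e1_def e2_def algebra_simps power2_eq_square)+
  have d11: "descends 2 (f 1 1 0)"
    by (rule descends_cong[OF e(2)]) (simp add: f_def e2_def)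
  have d21: "descends 3 (f 2 1 0)"
    by (rule descends_cong[OF descends_smult[OF descends_diff[OF descends_diff[OF e12
          descends_smult[OF e(3), of 3]] e(4)], of "1/2"]])
      (simp add: f_def e1_def e2_def e3_def \<delta>_def algebra_simps power2_eq_square)
  have d12: "descends 3 (f 1 2 0)"
    by (rule descends_cong[OF descends_smult[OF descends_add[OF descends_diff[OF e12
          descends_smult[OF e(3), of 3]] e(4)], of "1/2"]])
      (simp add: f_def e1_def e2_def e3_def \<delta>_def algebra_simps power2_eq_square)
  have d22: "descends 4 (f 2 2 0)"
    by (rule descends_cong[OF descends_diff[OF e22 descends_smult[OF e13, of 2]]])
      (simp add: f_def e1_def e2_def e3_def algebra_simps power2_eq_square)
  have small: "descends (a + b + 0) (f a b 0)" if "a \<in> {0, 1, 2}" "b \<in> {0, 1, 2}" for a b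
    using that d00 d10 d20 d11 d21 d12 d22 by (auto simp: eval_nat_numeral)
  have ab0: "descends (a + b + 0) (f a b 0)" if "b \<in> {0, 1, 2}" for a b
    by (rule reduce) (rule small[OF _ that])
  have a0b: "descends (b + 0 + a) (f b 0 a)" for a b
    by (rule reduce, rule rot, rule rot, rule ab0)
  have zero: "descends (a + b + 0) (f a b 0)" for a b
    using rot[OF a0b] by blast
  \<comment> \<open>A power of the product \<open>e3\<close> can be split off until one of the exponents is zero.\<close>
  have "descends (a + b + c) (f a b c)"
  proof (induction c arbitrary: a b)
    case 0
    show ?case by (rule zero)
  next
    case (Suc c)
    show ?case
    proof (cases "a = 0 \<or> b = 0")
      case True
      then show ?thesis
      proof
        assume "a = 0"
        then show ?thesis using rot[OF zero[of b "Suc c"]] by simp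
      next
        assume "b = 0"
        then show ?thesis using rot[OF rot[OF zero[of "Suc c" a]]] by simp
      qed
    next
      case False
      then obtain a' b' where ab: "a = Suc a'" "b = Suc b'" by (metis not0_implies_Suc)
      have "descends (a + b + Suc c) (\<lambda>v. e3 v * f a' b' c v)"
        by (rule descends_mult[OF e(3) Suc.IH]) (simp add: ab)
      then show ?thesis
        by (rule descends_cong) (simp add: ab f_def e3_def algebra_simps)
    qed
  qed
  then show ?thesis unfolding f_def .
qed

section \<open>The action of the group\<close>

definition permute_vec :: "('n \<Rightarrow> 'n) \<Rightarrow> complex ^ 'n \<Rightarrow> complex ^ 'n" where
  "permute_vec p x = (\<chi> i. x $ inv_into UNIV p i)"

definition transposition :: "5 \<Rightarrow> 5" where "transposition = cycle_of_list [1, 2]"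
definition three_cycle :: "5 \<Rightarrow> 5" where "three_cycle = cycle_of_list [3, 4, 5]"

definition swap_vec :: "complex ^ 5 \<Rightarrow> complex ^ 5" where "swap_vec = permute_vec transposition"
definition rot_vec :: "complex ^ 5 \<Rightarrow> complex ^ 5" where "rot_vec = permute_vec three_cycle"

lemma bij_transposition: "bij transposition" and bij_three_cycle: "bij three_cycle"
  unfolding transposition_def three_cycle_def
  by (rule permutation_bijective[OF permutation_of_cycle])+

lemma swap_vec_nth [simp]:
  "swap_vec x $ 1 = x $ 2" "swap_vec x $ 2 = x $ 1" "swap_vec x $ 3 = x $ 3"
  "swap_vec x $ 4 = x $ 4" "swap_vec x $ 5 = x $ 5"
  unfolding swap_vec_def permute_vec_def vec_lambda_beta
  by (rule arg_cong[where f = "($) x"], rule inv_f_eq[OF bij_is_inj[OF bij_transposition]],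
      simp add: transposition_def)+

lemma rot_vec_nth [simp]:
  "rot_vec x $ 1 = x $ 1" "rot_vec x $ 2 = x $ 2" "rot_vec x $ 3 = x $ 5"
  "rot_vec x $ 4 = x $ 3" "rot_vec x $ 5 = x $ 4"
  unfolding rot_vec_def permute_vec_def vec_lambda_beta
  by (rule arg_cong[where f = "($) x"], rule inv_f_eq[OF bij_is_inj[OF bij_three_cycle]],
      simp add: three_cycle_def)+

lemma vec5_eqI:
  fixes v w :: "complex ^ 5"
  shows "v $ 1 = w $ 1 \<Longrightarrow> v $ 2 = w $ 2 \<Longrightarrow> v $ 3 = w $ 3 \<Longrightarrow> v $ 4 = w $ 4 \<Longrightarrow> v $ 5 = w $ 5 \<Longrightarrow> v = w"
  by (simp add: vec_eq_iff forall_5)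

lemma rot_swap: "rot_vec (swap_vec v) = swap_vec (rot_vec v)"
  by (rule vec5_eqI) simp_all

lemma rot_funpow_swap: "(rot_vec ^^ i) (swap_vec v) = swap_vec ((rot_vec ^^ i) v)"
  by (induction i) (simp_all add: rot_swap)

lemma rot_funpow_swap_funpow: "(rot_vec ^^ i) ((swap_vec ^^ j) v) = (swap_vec ^^ j) ((rot_vec ^^ i) v)"
  by (induction j arbitrary: v) (simp_all add: rot_funpow_swap)

lemma invariants_eq_iff:
  "invariants v = invariants w \<longleftrightarrow>
     v $ 1 + v $ 2 = w $ 1 + w $ 2 \<and> v $ 1 * v $ 2 = w $ 1 * w $ 2 \<and>
     (v $ 3 - v $ 4) * (v $ 4 - v $ 5) * (v $ 5 - v $ 3) =
     (w $ 3 - w $ 4) * (w $ 4 - w $ 5) * (w $ 5 - w $ 3)"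
  by (simp add: vec_eq_iff forall_3 invariants_def)

lemma invariants_swap_rot: "invariants (swap_vec v) = invariants v" "invariants (rot_vec v) = invariants v"
  by (simp_all add: invariants_eq_iff mult_ac)

lemma bring_cone_swap_rot:
  "v \<in> bring_cone \<Longrightarrow> swap_vec v \<in> bring_cone" "v \<in> bring_cone \<Longrightarrow> rot_vec v \<in> bring_cone"
  by (simp_all add: bring_cone_def sum_5 add_ac)

lemma invariants_funpow: "invariants ((rot_vec ^^ i) ((swap_vec ^^ j) v)) = invariants v"
proof -
  have "invariants ((swap_vec ^^ j) v) = invariants v"
    by (induction j) (simp_all add: invariants_swap_rot)
  then show ?thesis by (induction i) (simp_all add: invariants_swap_rot)
qed

lemma bring_cone_funpow: "v \<in> bring_cone \<Longrightarrow> (rot_vec ^^ i) ((swap_vec ^^ j) v) \<in> bring_cone"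
proof -
  assume "v \<in> bring_cone"
  then have "(swap_vec ^^ j) v \<in> bring_cone"
    by (induction j) (simp_all add: bring_cone_swap_rot)
  then show ?thesis by (induction i) (simp_all add: bring_cone_swap_rot)
qed

lemma same_invariants_pair:
  fixes a b a' b' :: complex
  assumes "a + b = a' + b'" "a * b = a' * b'"
  shows "a' = a \<and> b' = b \<or> a' = b \<and> b' = a"
proof -
  have "(a' - a) * (a' - b) = 0" using assms by algebra
  then show ?thesis using assms(1) by (auto simp: add.commute)
qed

text \<open>
  Equality of the elementary symmetric functions leaves all six permutations; a transposition
  changes the sign of the discriminant root, so it can only occur when two of the numbers coincide,
  and then its effect is also that of a cyclic permutation.
\<close>

lemma same_invariants_triple:
  fixes a b c a' b' c' :: complex
  assumes "a + b + c = a' + b' + c'" "a * b + b * c + c * a = a' * b' + b' * c' + c' * a'"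
    "a * b * c = a' * b' * c'"
    "(a - b) * (b - c) * (c - a) = (a' - b') * (b' - c') * (c' - a')"
  shows "(a', b', c') \<in> {(a, b, c), (b, c, a), (c, a, b)}"
proof -
  have first: "(x', y', z') \<in> {(x, y, z), (y, z, x), (z, x, y)}"
    if x: "x' = x" and s: "x + y + z = x' + y' + z'" "x * y + y * z + z * x = x' * y' + y' * z' + z' * x'"
      and \<delta>: "(x - y) * (y - z) * (z - x) = (x' - y') * (y' - z') * (z' - x')"
    for x y z x' y' z' :: complex
  proof -
    have "y + z = y' + z'" using x s by simp
    moreover have "y * z = y' * z'"
    proof -
      have "b * c = (a * b + b * c + c * a) - a * (b + c)" for a b c :: complex by algebra
      then show ?thesis using x s calculation by metis
    qed
    ultimately consider "y' = y" "z' = z" | "y' = z" "z' = y"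
      using same_invariants_pair by blast
    then show ?thesis
    proof cases
      case 2
      with \<delta> x have "2 * ((x - y) * (y - z) * (z - x)) = 0" by algebra
      then have "x = y \<or> y = z \<or> z = x" by auto
      then show ?thesis using 2 x by auto
    qed (use x in simp)
  qed
  have "(a' - a) * (a' - b) * (a' - c) = 0" using assms by algebra
  then consider "a' = a" | "a' = b" | "a' = c" by auto
  then show ?thesis
  proof cases
    case 1
    show ?thesis by (rule first[OF 1 assms(1,2,4)])
  next
    case 2
    have "(a', b', c') \<in> {(b, c, a), (c, a, b), (a, b, c)}"
    proof (rule first[OF 2])
      show "b + c + a = a' + b' + c'" using assms(1) by algebra
      show "b * c + c * a + a * b = a' * b' + b' * c' + c' * a'" using assms(2) by algebra
      show "(b - c) * (c - a) * (a - b) = (a' - b') * (b' - c') * (c' - a')"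
        using assms(4) by algebra
    qed
    then show ?thesis by blast
  next
    case 3
    have "(a', b', c') \<in> {(c, a, b), (a, b, c), (b, c, a)}"
    proof (rule first[OF 3])
      show "c + a + b = a' + b' + c'" using assms(1) by algebra
      show "c * a + a * b + b * c = a' * b' + b' * c' + c' * a'" using assms(2) by algebra
      show "(c - a) * (a - b) * (b - c) = (a' - b') * (b' - c') * (c' - a')"
        using assms(4) by algebra
    qed
    then show ?thesis by blast
  qed
qed

lemma same_invariants:
  assumes "v \<in> bring_cone" "w \<in> bring_cone" "invariants v = invariants w"
  obtains i j where "w = (rot_vec ^^ i) ((swap_vec ^^ j) v)"
proof -
  have "w $ 1 = v $ 1 \<and> w $ 2 = v $ 2 \<or> w $ 1 = v $ 2 \<and> w $ 2 = v $ 1"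
    using assms(3) by (intro same_invariants_pair) (simp_all add: invariants_eq_iff)
  then have "\<exists>j. w $ 1 = (swap_vec ^^ j) v $ 1 \<and> w $ 2 = (swap_vec ^^ j) v $ 2"
  proof (elim disjE)
    assume "w $ 1 = v $ 1 \<and> w $ 2 = v $ 2"
    then show ?thesis by (intro exI[of _ 0]) simp
  next
    assume "w $ 1 = v $ 2 \<and> w $ 2 = v $ 1"
    then show ?thesis by (intro exI[of _ 1]) simp
  qed
  then obtain j where j: "w $ 1 = (swap_vec ^^ j) v $ 1" "w $ 2 = (swap_vec ^^ j) v $ 2" by blast
  have unmoved: "(swap_vec ^^ j) v $ 3 = v $ 3" "(swap_vec ^^ j) v $ 4 = v $ 4" "(swap_vec ^^ j) v $ 5 = v $ 5"
    by (induction j) simp_all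
  have "(w $ 3, w $ 4, w $ 5) \<in> {(v $ 3, v $ 4, v $ 5), (v $ 4, v $ 5, v $ 3), (v $ 5, v $ 3, v $ 4)}"
    using assms(3)[unfolded invariants_eq_iff] assms(1,2)[unfolded bring_cone_iff Let_def]
    by (intro same_invariants_triple) (simp_all only:)
  then consider "w $ 3 = v $ 3" "w $ 4 = v $ 4" "w $ 5 = v $ 5"
    | "w $ 3 = v $ 4" "w $ 4 = v $ 5" "w $ 5 = v $ 3"
    | "w $ 3 = v $ 5" "w $ 4 = v $ 3" "w $ 5 = v $ 4" by auto
  then show ?thesis
  proof cases
    case 1
    then show ?thesis by (intro that[of 0 j] vec5_eqI) (simp_all add: j unmoved)
  next
    case 2
    then show ?thesis by (intro that[of 2 j] vec5_eqI) (simp_all add: j unmoved numeral_2_eq_2)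
  next
    case 3
    then show ?thesis by (intro that[of 1 j] vec5_eqI) (simp_all add: j unmoved)
  qed
qed

lemma permute_vec_compose:
  "bij p \<Longrightarrow> bij q \<Longrightarrow> permute_vec (p \<circ> q) = permute_vec p \<circ> permute_vec q"
  by (simp add: permute_vec_def fun_eq_iff o_inv_distrib)

lemma permute_vec_id: "permute_vec id = id"
  by (simp add: permute_vec_def fun_eq_iff inv_id)

lemma permute_coords_line: "permute_coords p (vec.span {v}) = vec.span {permute_vec p v}"
proof -
  have "(\<chi> i. (c *s v) $ inv_into UNIV p i) = c *s permute_vec p v" for c
    by (simp add: vec_eq_iff permute_vec_def)
  then show ?thesis by (simp add: permute_coords_def span_line image_image)
qed

lemma cycles_in_S5: "transposition \<in> carrier S5" "three_cycle \<in> carrier S5"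
  using bij_transposition bij_three_cycle by (auto simp: BijGroup_def Bij_def)

lemma S5_mult: "p \<in> carrier S5 \<Longrightarrow> q \<in> carrier S5 \<Longrightarrow> p \<otimes>\<^bsub>S5\<^esub> q = p \<circ> q"
  by (simp add: BijGroup_def compose_def fun_eq_iff)

lemma S5_bij: "p \<in> carrier S5 \<Longrightarrow> bij p"
  by (simp add: BijGroup_def Bij_def)

lemma generate_permute_vec:
  assumes "g \<in> generate S5 {transposition, three_cycle}"
  shows "g \<in> carrier S5 \<and> (\<exists>i j. permute_vec g = (rot_vec ^^ i) \<circ> (swap_vec ^^ j))"
  using assms
proof (induction rule: generate.induct)
  case one
  have "\<one>\<^bsub>S5\<^esub> = id" by (simp add: BijGroup_def fun_eq_iff)
  then have "permute_vec \<one>\<^bsub>S5\<^esub> = (rot_vec ^^ 0) \<circ> (swap_vec ^^ 0)"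
    by (simp add: permute_vec_id)
  then show ?case using group.is_monoid[OF group_BijGroup] monoid.one_closed by blast
next
  case (incl h)
  have "permute_vec transposition = (rot_vec ^^ 0) \<circ> (swap_vec ^^ 1)"
    "permute_vec three_cycle = (rot_vec ^^ 1) \<circ> (swap_vec ^^ 0)"
    by (simp_all add: swap_vec_def rot_vec_def)
  with incl cycles_in_S5 show ?case by blast
next
  case (inv h)
  have eq: "permute_vec (inv\<^bsub>S5\<^esub> p) x = (\<chi> i. x $ p i)" if "p \<in> carrier S5" for p x
  proof -
    have "p \<in> Bij UNIV" using that by (simp add: BijGroup_def)
    then have "inv\<^bsub>S5\<^esub> p = inv_into UNIV p" "bij p"
      by (simp add: inv_BijGroup restrict_def, simp add: Bij_def)
    then show ?thesis by (simp add: permute_vec_def inv_inv_eq)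
  qed
  have "permute_vec (inv\<^bsub>S5\<^esub> transposition) = (rot_vec ^^ 0) \<circ> (swap_vec ^^ 1)"
    by (rule ext, rule vec5_eqI)
      (simp_all only: eq[OF cycles_in_S5(1)], simp_all add: transposition_def)
  moreover have "permute_vec (inv\<^bsub>S5\<^esub> three_cycle) = (rot_vec ^^ 2) \<circ> (swap_vec ^^ 0)"
    by (rule ext, rule vec5_eqI)
      (simp_all only: eq[OF cycles_in_S5(2)], simp_all add: three_cycle_def numeral_2_eq_2)
  moreover have "inv\<^bsub>S5\<^esub> h \<in> carrier S5"
    using inv cycles_in_S5 by (intro group.inv_closed[OF group_BijGroup]) auto
  ultimately show ?case using inv by blast
next
  case (eng g h)
  then obtain i j k l where "permute_vec g = (rot_vec ^^ i) \<circ> (swap_vec ^^ j)"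
    "permute_vec h = (rot_vec ^^ k) \<circ> (swap_vec ^^ l)" by blast
  then have "permute_vec (g \<otimes>\<^bsub>S5\<^esub> h) = (rot_vec ^^ (i + k)) \<circ> (swap_vec ^^ (j + l))"
    using eng by (simp add: S5_mult permute_vec_compose S5_bij fun_eq_iff funpow_add rot_funpow_swap_funpow)
  moreover have "g \<otimes>\<^bsub>S5\<^esub> h \<in> carrier S5"
    using eng by (intro monoid.m_closed[OF group.is_monoid[OF group_BijGroup]]) simp_all
  ultimately show ?case by blast
qed

lemma generate_has_permute_vec:
  "\<exists>g\<in>generate S5 {transposition, three_cycle}. permute_vec g = (rot_vec ^^ i) \<circ> (swap_vec ^^ j)"
proof (induction i)
  case 0
  show ?case
  proof (induction j)
    case 0
    have "\<one>\<^bsub>S5\<^esub> = id" by (simp add: BijGroup_def fun_eq_iff)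
    then have "id \<in> generate S5 {transposition, three_cycle}" using generate.one[of S5] by metis
    moreover have "permute_vec id = (rot_vec ^^ 0) \<circ> (swap_vec ^^ 0)" by (simp add: permute_vec_id)
    ultimately show ?case by blast
  next
    case (Suc j)
    then obtain g where g: "g \<in> generate S5 {transposition, three_cycle}"
      "permute_vec g = (rot_vec ^^ 0) \<circ> (swap_vec ^^ j)" by blast
    have "transposition \<otimes>\<^bsub>S5\<^esub> g = transposition \<circ> g" "bij g"
      using g generate_permute_vec cycles_in_S5 by (auto simp: S5_mult S5_bij)
    then have "permute_vec (transposition \<otimes>\<^bsub>S5\<^esub> g) = (rot_vec ^^ 0) \<circ> (swap_vec ^^ Suc j)"
      using g by (simp only: permute_vec_compose bij_transposition bij_three_cycle) (simp add: swap_vec_def comp_assoc)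
    moreover have "transposition \<otimes>\<^bsub>S5\<^esub> g \<in> generate S5 {transposition, three_cycle}"
      by (rule generate.eng[OF generate.incl g(1)]) simp
    ultimately show ?case by blast
  qed
next
  case (Suc i)
  then obtain g where g: "g \<in> generate S5 {transposition, three_cycle}"
    "permute_vec g = (rot_vec ^^ i) \<circ> (swap_vec ^^ j)" by blast
  have "three_cycle \<otimes>\<^bsub>S5\<^esub> g = three_cycle \<circ> g" "bij g"
    using g generate_permute_vec cycles_in_S5 by (auto simp: S5_mult S5_bij)
  then have "permute_vec (three_cycle \<otimes>\<^bsub>S5\<^esub> g) = (rot_vec ^^ Suc i) \<circ> (swap_vec ^^ j)"
    using g by (simp only: permute_vec_compose bij_transposition bij_three_cycle) (simp add: rot_vec_def comp_assoc)
  moreover have "three_cycle \<otimes>\<^bsub>S5\<^esub> g \<in> generate S5 {transposition, three_cycle}"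
    by (rule generate.eng[OF generate.incl g(1)]) simp
  ultimately show ?case by blast
qed

lemma orbit_line:
  "orbit (subgroup_generated S5 {transposition, three_cycle}) permute_coords (vec.span {v}) =
     {vec.span {(rot_vec ^^ i) ((swap_vec ^^ j) v)} | i j. True}"
proof -
  have "carrier S5 \<inter> {transposition, three_cycle} = {transposition, three_cycle}"
    using cycles_in_S5 by blast
  then have "carrier (subgroup_generated S5 {transposition, three_cycle}) =
      generate S5 {transposition, three_cycle}"
    by (simp only: carrier_subgroup_generated)
  then have "orbit (subgroup_generated S5 {transposition, three_cycle}) permute_coords (vec.span {v}) =
      {vec.span {permute_vec g v} | g. g \<in> generate S5 {transposition, three_cycle}}"
    by (simp only: orbit_def permute_coords_line)
  also have "\<dots> = {vec.span {(rot_vec ^^ i) ((swap_vec ^^ j) v)} | i j. True}"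
  proof (intro subset_antisym subsetI)
    fix L assume "L \<in> {vec.span {permute_vec g v} | g. g \<in> generate S5 {transposition, three_cycle}}"
    then obtain g where g: "L = vec.span {permute_vec g v}" "g \<in> generate S5 {transposition, three_cycle}"
      by blast
    then obtain i j where "permute_vec g = (rot_vec ^^ i) \<circ> (swap_vec ^^ j)"
      using generate_permute_vec by blast
    then show "L \<in> {vec.span {(rot_vec ^^ i) ((swap_vec ^^ j) v)} | i j. True}"
      using g(1) by auto
  next
    fix L assume "L \<in> {vec.span {(rot_vec ^^ i) ((swap_vec ^^ j) v)} | i j. True}"
    then obtain i j where L: "L = vec.span {(rot_vec ^^ i) ((swap_vec ^^ j) v)}" by blast
    obtain g where "g \<in> generate S5 {transposition, three_cycle}"
      "permute_vec g = (rot_vec ^^ i) \<circ> (swap_vec ^^ j)" using generate_has_permute_vec by blast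
    with L show "L \<in> {vec.span {permute_vec g v} | g. g \<in> generate S5 {transposition, three_cycle}}"
      by (intro CollectI exI[of _ g]) simp
  qed
  finally show ?thesis .
qed

section \<open>Symmetrised forms\<close>

text \<open>
  Up to the factor 6, the mean over the group. The exponents run over one period of each generator,
  so that every element of the group occurs exactly once.
\<close>

definition symmetrise :: "(complex ^ 5 \<Rightarrow> complex) \<Rightarrow> complex ^ 5 \<Rightarrow> complex" where
  "symmetrise F v = (\<Sum>(i, j)\<in>{..<3} \<times> {..<2}. F ((rot_vec ^^ i) ((swap_vec ^^ j) v)))"

lemma symmetrise_expand:
  "symmetrise F v = F v + F (swap_vec v) + F (rot_vec v) + F (rot_vec (swap_vec v)) +
     F (rot_vec (rot_vec v)) + F (rot_vec (rot_vec (swap_vec v)))"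
  by (simp add: symmetrise_def sum.cartesian_product[symmetric] numeral_3_eq_3 numeral_2_eq_2 add_ac)

text \<open>
  The group is the product of the groups acting on \<open>x\<^sub>1, x\<^sub>2\<close> and on \<open>x\<^sub>3, x\<^sub>4, x\<^sub>5\<close>, so symmetrising a
  monomial gives the product of a sum over the transposition and a cyclic sum.
\<close>

lemma descends_symmetrise:
  assumes "form d F"
  shows "descends d (symmetrise F)"
  using form_imp_weighted[OF assms]
proof (induction rule: weighted_form.induct)
  case (weighted_monomial d m c)
  let ?A = "\<lambda>v :: complex ^ 5. v $ 1 ^ m 1 * v $ 2 ^ m 2 + v $ 2 ^ m 1 * v $ 1 ^ m 2"
  let ?C = "\<lambda>v :: complex ^ 5. v $ 3 ^ m 3 * v $ 4 ^ m 4 * v $ 5 ^ m 5 +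
     v $ 4 ^ m 3 * v $ 5 ^ m 4 * v $ 3 ^ m 5 + v $ 5 ^ m 3 * v $ 3 ^ m 4 * v $ 4 ^ m 5"
  have "descends d (\<lambda>v. c * (?A v * ?C v))"
    by (intro descends_smult descends_mult[OF descends_swap_sum descends_cyclic_sum])
      (simp add: weighted_monomial sum_5)
  moreover have "symmetrise (\<lambda>v. c * (\<Prod>i\<in>UNIV. v $ i ^ m i)) = (\<lambda>v. c * (?A v * ?C v))"
    by (rule ext) (simp add: symmetrise_expand prod_5 algebra_simps)
  ultimately show ?case by simp
next
  case (weighted_add d F G)
  have "symmetrise (\<lambda>v. F v + G v) = (\<lambda>v. symmetrise F v + symmetrise G v)"
    by (rule ext) (simp add: symmetrise_expand)
  with weighted_add descends_add show ?case by simp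
qed

lemma power_sum_nonzero:
  fixes z :: "'i \<Rightarrow> complex"
  assumes "finite I" "i\<^sub>0 \<in> I" "z i\<^sub>0 \<noteq> 0"
  obtains k where "k > 0" "(\<Sum>i\<in>I. z i ^ k) \<noteq> 0"
proof (rule ccontr)
  assume "\<not> thesis"
  with that have zero: "(\<Sum>i\<in>I. z i ^ k) = 0" if "k > 0" for k using that by blast
  \<comment> \<open>A polynomial without constant term that is nonzero at \<open>z i\<^sub>0\<close> and vanishes at the other values.\<close>
  define p where "p = [:0, 1:] * (\<Prod>w\<in>z ` I - {z i\<^sub>0}. [:- w, 1:])"
  have p: "poly p x = x * (\<Prod>w\<in>z ` I - {z i\<^sub>0}. x - w)" for x
    by (simp add: p_def poly_prod)
  have nz: "poly p (z i\<^sub>0) \<noteq> 0"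
    using assms by (auto simp: p)
  have other: "poly p (z i) = (if z i = z i\<^sub>0 then poly p (z i\<^sub>0) else 0)" if "i \<in> I" for i
    using that assms by (auto simp: p)
  have "(\<Sum>i\<in>I. poly p (z i)) = of_nat (card {i \<in> I. z i = z i\<^sub>0}) * poly p (z i\<^sub>0)"
    using assms(1) by (simp add: other sum.If_cases Int_def)
  moreover have "card {i \<in> I. z i = z i\<^sub>0} \<noteq> 0"
    using assms by auto
  moreover have "(\<Sum>i\<in>I. poly p (z i)) = (\<Sum>k\<le>degree p. coeff p k * (\<Sum>i\<in>I. z i ^ k))"
    unfolding poly_altdef by (subst sum.swap) (simp add: sum_distrib_left)
  moreover have "coeff p k * (\<Sum>i\<in>I. z i ^ k) = 0" for k
    using zero[of k] by (cases "k = 0") (simp_all add: p_def)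
  ultimately show False using nz by simp
qed

text \<open>
  The mean of a form may vanish where the form does not, but the means of its powers cannot all
  vanish.
\<close>

lemma symmetrise_power_nonzero:
  assumes "F v \<noteq> 0"
  obtains k where "k > 0" "symmetrise (\<lambda>v. F v ^ (3 * k)) v \<noteq> 0"
proof -
  have "(0, 0) \<in> {..<3::nat} \<times> {..<2::nat}" "finite ({..<3::nat} \<times> {..<2::nat})" by simp_all
  then obtain k where "k > 0"
    "(\<Sum>p\<in>{..<3} \<times> {..<2}. (F ((rot_vec ^^ fst p) ((swap_vec ^^ snd p) v)) ^ 3) ^ k) \<noteq> 0"
    using power_sum_nonzero[of "{..<3} \<times> {..<2}" "(0, 0)"
        "\<lambda>p. F ((rot_vec ^^ fst p) ((swap_vec ^^ snd p) v)) ^ 3"] assms by auto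
  then show ?thesis
    by (intro that[of k]) (simp_all add: symmetrise_def case_prod_beta power_mult)
qed

lemma symmetrise_nonzero:
  assumes "symmetrise F v \<noteq> 0"
  obtains i j where "F ((rot_vec ^^ i) ((swap_vec ^^ j) v)) \<noteq> 0"
proof -
  have "\<exists>p\<in>{..<3} \<times> {..<2}. (case p of (i, j) \<Rightarrow> F ((rot_vec ^^ i) ((swap_vec ^^ j) v))) \<noteq> 0"
    using assms sum.neutral unfolding symmetrise_def by meson
  then show ?thesis using that by auto
qed


section \<open>The map to the Weierstrass cubic\<close>

text \<open>
  With \<open>u\<^sub>1 = 1\<close> the discriminant curve is \<open>u\<^sub>3\<^sup>2 = 4 u\<^sub>2\<^sup>3 - 83 u\<^sub>2\<^sup>2 + 72 u\<^sub>2 - 16\<close>. Substituting \<open>u\<^sub>2 = (1 - x) / 4\<close>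
  turns the right side into \<open>- (x\<^sup>3 + 80 x\<^sup>2 + 125 x + 50) / 16\<close>; as \<open>(48 \<i> \<surd>3)\<^sup>2 = - 432 * 16\<close>, the
  curve becomes the required one for \<open>y = 48 \<i> \<surd>3 u\<^sub>3\<close>. The map is this substitution, homogenised
  with \<open>u\<^sub>1\<^sup>3\<close>.
\<close>

definition model_map :: "complex ^ 3 \<Rightarrow> complex ^ 3" where
  "model_map u = vector [u $ 1 ^ 3 - 4 * (u $ 1 * u $ 2), 48 * \<i> * sqrt 3 * u $ 3, u $ 1 ^ 3]"

definition model_cone :: "(complex ^ 3) set" where
  "model_cone = {v. (v $ 2)\<^sup>2 * v $ 3 =
     432 * ((v $ 1) ^ 3 + 80 * (v $ 1)\<^sup>2 * v $ 3 + 125 * v $ 1 * (v $ 3)\<^sup>2 + 50 * (v $ 3) ^ 3)}"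

lemma model_constant: "(48 * \<i> * complex_of_real (sqrt 3))\<^sup>2 = - 6912" "48 * \<i> * complex_of_real (sqrt 3) \<noteq> 0"
proof -
  have "(complex_of_real (sqrt 3))\<^sup>2 = 3"
    by (simp flip: of_real_power)
  then show "(48 * \<i> * complex_of_real (sqrt 3))\<^sup>2 = - 6912" by (simp add: power_mult_distrib)
  then show "48 * \<i> * complex_of_real (sqrt 3) \<noteq> 0" by auto
qed

lemma model_map_nth [simp]:
  "model_map u $ 1 = u $ 1 ^ 3 - 4 * (u $ 1 * u $ 2)"
  "model_map u $ 2 = 48 * \<i> * sqrt 3 * u $ 3"
  "model_map u $ 3 = u $ 1 ^ 3"
  by (simp_all add: model_map_def)

lemma model_map_in_cone:
  assumes "u \<in> discriminant_curve"
  shows "model_map u \<in> model_cone"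
proof -
  define \<kappa> where "\<kappa> = 48 * \<i> * complex_of_real (sqrt 3)"
  have \<kappa>: "\<kappa>\<^sup>2 = - 6912" unfolding \<kappa>_def by (rule model_constant)
  have "(u $ 3)\<^sup>2 =
     4 * (u $ 2) ^ 3 - 83 * (u $ 1)\<^sup>2 * (u $ 2)\<^sup>2 + 72 * (u $ 1) ^ 4 * u $ 2 - 16 * (u $ 1) ^ 6"
    using assms by (simp add: discriminant_curve_def)
  with \<kappa> show ?thesis
    unfolding model_cone_def mem_Collect_eq model_map_nth \<kappa>_def[symmetric] by algebra
qed

text \<open>
  On the curve, \<open>u\<^sub>1 u\<^sub>2\<close>, \<open>u\<^sub>1\<^sup>3\<close>, \<open>u\<^sub>3\<close> are linear and \<open>u\<^sub>2\<^sup>3\<close> is quadratic in the coordinates of the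
  image. When the weight \<open>a + 2 b + 3 k\<close> is a multiple of 3 and \<open>b < 3\<close>, then \<open>a - b\<close> is
  a nonnegative multiple of 3, so that the monomial is a product of these.
\<close>

lemma monomial_pullback:
  assumes "a + 2 * b + 3 * k = 3 * m"
  shows "\<exists>\<Phi>. form m \<Phi> \<and>
    (\<forall>u\<in>discriminant_curve. u $ 1 ^ a * u $ 2 ^ b * u $ 3 ^ k = \<Phi> (model_map u))"
  using assms
proof (induction b arbitrary: m rule: less_induct)
  case (less b)
  define \<kappa> where "\<kappa> = 48 * \<i> * complex_of_real (sqrt 3)"
  have \<kappa>: "\<kappa>\<^sup>2 = - 6912" "\<kappa> \<noteq> 0" unfolding \<kappa>_def by (rule model_constant)+
  define U D C :: "complex ^ 3 \<Rightarrow> complex" where "U w = 1/4 * (w $ 3 - w $ 1)"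
    and "D w = 1 / \<kappa> * w $ 2"
    and "C w = 1/4 * (D w ^ 2 + 83 * U w ^ 2 - 72 * (U w * w $ 3) + 16 * w $ 3 ^ 2)" for w
  have U: "form 1 U" and D: "form 1 D"
    unfolding U_def D_def by (intro form_smult form_diff form_coord)+
  have UZ: "form 2 (\<lambda>w. U w * w $ 3)" by (rule form_mult'[OF U form_coord]) simp
  have C: "form 2 C"
    unfolding C_def
    using UZ form_power[OF U, of 2] form_power[OF D, of 2] form_power[OF form_coord, of 2]
    by (intro form_smult form_add form_diff) simp_all
  have val: "U (model_map u) = u $ 1 * u $ 2" "D (model_map u) = u $ 3" for u
    using \<kappa>(2) by (simp_all add: U_def D_def \<kappa>_def[symmetric])
  have valC: "C (model_map u) = u $ 2 ^ 3" if "u \<in> discriminant_curve" for u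
    using that unfolding C_def val model_map_nth discriminant_curve_def
    by (simp add: power_mult_distrib algebra_simps flip: power_add power_mult power_Suc power_Suc2)
  show ?case
  proof (cases "b < 3")
    case True
    have le: "b + k \<le> m" using less.prems True by linarith
    define n where "n = m - b - k"
    have n: "a = 3 * n + b" "m = n + b + k" using less.prems le by (simp_all add: n_def)
    show ?thesis
    proof (intro exI conjI ballI)
      show "form m (\<lambda>w. w $ 3 ^ n * U w ^ b * D w ^ k)"
        using form_power[OF form_coord, of n 3] form_power[OF U, of b] form_power[OF D, of k]
        by (intro form_mult'[OF form_mult']) (simp_all add: n)
      show "u $ 1 ^ a * u $ 2 ^ b * u $ 3 ^ k =
          model_map u $ 3 ^ n * U (model_map u) ^ b * D (model_map u) ^ k" for u
        by (simp add: val n power_add power_mult power_mult_distrib)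
    qed
  next
    case False
    have "a + 2 * (b - 3) + 3 * k = 3 * (m - 2)" using less.prems False by simp
    then obtain \<Phi> where \<Phi>: "form (m - 2) \<Phi>"
      "\<And>u. u \<in> discriminant_curve \<Longrightarrow> u $ 1 ^ a * u $ 2 ^ (b - 3) * u $ 3 ^ k = \<Phi> (model_map u)"
      using less.IH[of "b - 3" "m - 2"] False by auto
    show ?thesis
    proof (intro exI conjI ballI)
      show "form m (\<lambda>w. \<Phi> w * C w)"
        by (rule form_mult'[OF \<Phi>(1) C]) (use less.prems False in simp)
      fix u assume u: "u \<in> discriminant_curve"
      have "u $ 2 ^ b = u $ 2 ^ (b - 3) * u $ 2 ^ 3"
        using False by (simp flip: power_add)
      then show "u $ 1 ^ a * u $ 2 ^ b * u $ 3 ^ k = \<Phi> (model_map u) * C (model_map u)"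
        by (simp add: valC[OF u] \<Phi>(2)[OF u, symmetric] mult_ac)
    qed
  qed
qed

lemma weighted_form_pullback:
  assumes "weighted_form invariant_degree d Q" "d = 3 * m"
  shows "\<exists>\<Phi>. form m \<Phi> \<and> (\<forall>u\<in>discriminant_curve. Q u = \<Phi> (model_map u))"
  using assms
proof (induction rule: weighted_form.induct)
  case (weighted_monomial d e c)
  then have "e 1 + 2 * e 2 + 3 * e 3 = 3 * m"
    by (simp add: sum_3 invariant_degree_def)
  then obtain \<Phi> where \<Phi>: "form m \<Phi>"
    "\<And>u. u \<in> discriminant_curve \<Longrightarrow> u $ 1 ^ e 1 * u $ 2 ^ e 2 * u $ 3 ^ e 3 = \<Phi> (model_map u)"
    using monomial_pullback by blast
  then show ?case
    by (intro exI[of _ "\<lambda>w. c * \<Phi> w"]) (simp add: form_smult prod_3)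
next
  case (weighted_add d F G)
  then obtain \<Phi> \<Psi> where "form m \<Phi>" "\<forall>u\<in>discriminant_curve. F u = \<Phi> (model_map u)"
    "form m \<Psi>" "\<forall>u\<in>discriminant_curve. G u = \<Psi> (model_map u)" by blast
  then show ?case
    by (intro exI[of _ "\<lambda>w. \<Phi> w + \<Psi> w"]) (simp add: form_add)
qed

definition bring_map :: "complex ^ 5 \<Rightarrow> complex ^ 3" where
  "bring_map v = model_map (invariants v)"

text \<open>
  Restricting to degrees divisible by 3 loses nothing: a fraction of invariant forms can be
  expanded by the square of its denominator, and a form vanishes where its cube does.
\<close>

lemma symmetrise_pullback:
  assumes "form (3 * m) F"
  obtains \<Phi> where "form m \<Phi>" "\<And>v. v \<in> bring_cone \<Longrightarrow> symmetrise F v = \<Phi> (bring_map v)"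
proof -
  obtain Q where Q: "weighted_form invariant_degree (3 * m) Q"
    "\<forall>v\<in>bring_cone. symmetrise F v = Q (invariants v)"
    using descends_symmetrise[OF assms] unfolding descends_def by blast
  obtain \<Phi> where "form m \<Phi>" "\<forall>u\<in>discriminant_curve. Q u = \<Phi> (model_map u)"
    using weighted_form_pullback[OF Q(1) refl] by blast
  then show ?thesis
    using that Q(2) invariants_in_discriminant_curve by (simp add: bring_map_def)
qed

lemma form_bring_map: "form 3 (\<lambda>v. bring_map v $ i)"
proof -
  have s: "form 1 (\<lambda>v :: complex ^ 5. v $ 1 + v $ 2)" by (intro form_add form_coord)
  have p: "form 2 (\<lambda>v :: complex ^ 5. v $ 1 * v $ 2)" by (rule form_mult'[OF form_coord form_coord]) simp
  have \<delta>: "form 3 (\<lambda>v :: complex ^ 5. (v $ 3 - v $ 4) * (v $ 4 - v $ 5) * (v $ 5 - v $ 3))"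
  proof -
    have diff: "form 1 (\<lambda>v :: complex ^ 5. v $ i - v $ j)" for i j by (intro form_diff form_coord)
    show ?thesis by (rule form_mult'[OF form_mult'[OF diff diff refl] diff]) simp
  qed
  have s3: "form 3 (\<lambda>v :: complex ^ 5. (v $ 1 + v $ 2) ^ 3)" using form_power[OF s, of 3] by simp
  have sp: "form 3 (\<lambda>v :: complex ^ 5. (v $ 1 + v $ 2) * (v $ 1 * v $ 2))"
    by (rule form_mult'[OF s p]) simp
  have "form 3 (\<lambda>v. bring_map v $ 1)" "form 3 (\<lambda>v. bring_map v $ 2)" "form 3 (\<lambda>v. bring_map v $ 3)"
    using form_diff[OF s3 form_smult[OF sp, of 4]] form_smult[OF \<delta>, of "48 * \<i> * sqrt 3"] s3
    by (simp_all add: bring_map_def invariants_def)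
  then show ?thesis using exhaust_3[of i] by auto
qed

lemma invariants_scale:
  "invariants (c *s v) = vector [c * invariants v $ 1, c\<^sup>2 * invariants v $ 2, c ^ 3 * invariants v $ 3]"
  by (simp add: vec_eq_iff forall_3 invariants_def algebra_simps power2_eq_square power3_eq_cube)

lemma bring_cone_scale: "v \<in> bring_cone \<Longrightarrow> c *s v \<in> bring_cone"
  by (simp add: bring_cone_def power_mult_distrib flip: sum_distrib_left)

lemma zero_in_bring_cone: "0 \<in> bring_cone"
  by (simp add: bring_cone_def)

lemma vec3_eqI:
  fixes v w :: "complex ^ 3"
  shows "v $ 1 = w $ 1 \<Longrightarrow> v $ 2 = w $ 2 \<Longrightarrow> v $ 3 = w $ 3 \<Longrightarrow> v = w"
  by (simp add: vec_eq_iff forall_3)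

text \<open>
  If the image vanishes then so do all three invariants. The origin has the same invariants, and
  points with equal invariants lie in one orbit.
\<close>

lemma bring_map_nonzero:
  assumes v: "v \<in> bring_cone" "v \<noteq> 0"
  shows "bring_map v \<noteq> 0"
proof
  assume 0: "bring_map v = 0"
  define u where "u = invariants v"
  have "model_map u = 0" using 0 by (simp add: bring_map_def u_def)
  then have "model_map u $ 3 = 0" "model_map u $ 2 = 0" by simp_all
  then have u13: "u $ 1 = 0" "u $ 3 = 0" using model_constant(2) by auto
  moreover have "u \<in> discriminant_curve" unfolding u_def by (rule invariants_in_discriminant_curve[OF v(1)])
  ultimately have "u $ 2 = 0" by (simp add: discriminant_curve_def)
  with u13 have "invariants 0 = invariants v"
    by (intro vec3_eqI) (simp_all add: invariants_def u_def)
  then obtain i j where "v = (rot_vec ^^ i) ((swap_vec ^^ j) 0)"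
    using same_invariants[OF zero_in_bring_cone v(1)] by blast
  moreover have "swap_vec 0 = 0" "rot_vec 0 = 0" by (rule vec5_eqI; simp)+
  then have "(swap_vec ^^ j) 0 = 0" "(rot_vec ^^ i) 0 = 0" by (induction j, simp_all) (induction i, simp_all)
  ultimately show False using v(2) by simp
qed

text \<open>
  Points of the weighted projective plane: proportional images force the invariants to agree up to
  the weighted action of a scalar. Where \<open>u\<^sub>1\<close> vanishes the scalar has to be recovered from its
  square and its cube.
\<close>

lemma bring_map_fibre:
  assumes v: "v \<in> bring_cone" and w: "w \<in> bring_cone" "w \<noteq> 0"
    and c: "c \<noteq> 0" "bring_map v = c *s bring_map w"
  obtains l where "l \<noteq> 0" "invariants v = invariants (l *s w)"
proof -
  define u t where "u = invariants v" and "t = invariants w"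
  have u: "u \<in> discriminant_curve" and t: "t \<in> discriminant_curve"
    unfolding u_def t_def by (intro invariants_in_discriminant_curve v w)+
  have "model_map u $ i = c * model_map t $ i" for i
    using c(2) by (simp add: bring_map_def u_def t_def)
  from this[of 1] this[of 2] this[of 3]
  have eq: "u $ 1 ^ 3 = c * t $ 1 ^ 3" "u $ 3 = c * t $ 3" "u $ 1 * u $ 2 = c * (t $ 1 * t $ 2)"
    using model_constant(2) by (simp_all add: algebra_simps)
  have "\<exists>l. l \<noteq> 0 \<and> u $ 1 = l * t $ 1 \<and> u $ 2 = l\<^sup>2 * t $ 2 \<and> u $ 3 = l ^ 3 * t $ 3"
  proof (cases "t $ 1 = 0")
    case False
    define l where "l = u $ 1 / t $ 1"
    have u1: "u $ 1 = l * t $ 1" using False by (simp add: l_def)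
    have l3: "l ^ 3 = c" using eq(1) False by (simp add: u1 power_mult_distrib)
    then have l: "l \<noteq> 0" using c(1) by auto
    have "l * t $ 1 * u $ 2 = l * t $ 1 * (l\<^sup>2 * t $ 2)"
      using eq(3) unfolding u1 l3[symmetric] by (simp add: power2_eq_square power3_eq_cube mult_ac)
    then have "u $ 2 = l\<^sup>2 * t $ 2" using l False by simp
    then show ?thesis using l u1 eq(2) l3 by blast
  next
    case True
    then have u1: "u $ 1 = 0" using eq(1) by simp
    have t3: "t $ 3 \<noteq> 0"
    proof
      assume "t $ 3 = 0"
      then have "bring_map w = 0"
        using True by (intro vec3_eqI) (simp_all add: bring_map_def flip: t_def)
      then show False using bring_map_nonzero w by blast
    qed
    have u3: "u $ 3 \<noteq> 0" using t3 eq(2) c(1) by simp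
    have sq: "(u $ 3)\<^sup>2 = 4 * u $ 2 ^ 3" "(t $ 3)\<^sup>2 = 4 * t $ 2 ^ 3"
      using u t u1 True by (simp_all add: discriminant_curve_def)
    have n2: "u $ 2 \<noteq> 0" "t $ 2 \<noteq> 0" using sq u3 t3 by auto
    define l where "l = (u $ 3 * t $ 2) / (t $ 3 * u $ 2)"
    have "l \<noteq> 0" using n2 u3 t3 by (simp add: l_def)
    moreover have l2: "l\<^sup>2 = u $ 2 / t $ 2"
    proof -
      have "l\<^sup>2 = ((u $ 3)\<^sup>2 * (t $ 2)\<^sup>2) / ((t $ 3)\<^sup>2 * (u $ 2)\<^sup>2)"
        by (simp add: l_def power_divide power_mult_distrib)
      also have "\<dots> = u $ 2 / t $ 2"
        unfolding sq using n2 by (simp add: divide_simps power2_eq_square power3_eq_cube)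
      finally show ?thesis .
    qed
    moreover have "l ^ 3 = u $ 3 / t $ 3"
    proof -
      have "l ^ 3 = l\<^sup>2 * l" by (simp add: power2_eq_square power3_eq_cube)
      also have "\<dots> = u $ 3 / t $ 3" unfolding l2 using n2 t3 by (simp add: l_def)
      finally show ?thesis .
    qed
    ultimately show ?thesis using True u1 n2 t3 by (intro exI[of _ l]) simp
  qed
  then obtain l where "l \<noteq> 0" "u $ 1 = l * t $ 1" "u $ 2 = l\<^sup>2 * t $ 2" "u $ 3 = l ^ 3 * t $ 3" by blast
  then show ?thesis
    by (intro that[of l]) (auto intro!: vec3_eqI simp: invariants_scale simp flip: u_def t_def)
qed

lemma quadratic_roots:
  fixes s p :: complex
  obtains a b where "a + b = s" "a * b = p"
proof
  let ?r = "csqrt (s\<^sup>2 - 4 * p)"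
  show "(s + ?r) / 2 + (s - ?r) / 2 = s" by (simp add: field_simps)
  have "(s + ?r) / 2 * ((s - ?r) / 2) = (s\<^sup>2 - ?r\<^sup>2) / 4" by (simp add: field_simps power2_eq_square)
  then show "(s + ?r) / 2 * ((s - ?r) / 2) = p" by simp
qed

lemma cubic_roots:
  fixes a b c :: complex
  obtains x y z where "x + y + z = a" "x * y + y * z + z * x = b" "x * y * z = c"
proof -
  have "\<not> constant (poly [:- c, b, - a, 1:])" by (simp add: constant_degree)
  then obtain x where "poly [:- c, b, - a, 1:] x = 0"
    using fundamental_theorem_of_algebra by blast
  then have x: "x * (b - x * (a - x)) = c" by (simp add: algebra_simps)
  obtain y z where yz: "y + z = a - x" "y * z = b - x * (a - x)" by (rule quadratic_roots)
  show ?thesis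
  proof (rule that[of x y z])
    show "x + y + z = a" using yz(1) by (simp add: algebra_simps)
    have "x * y + y * z + z * x = y * z + x * (y + z)" by (simp add: algebra_simps)
    then show "x * y + y * z + z * x = b" by (simp add: yz)
    show "x * y * z = c" using x yz(2) by (simp add: mult.assoc)
  qed
qed

text \<open>
  Solving a quadratic and a cubic equation gives the five coordinates, up to the sign of the
  discriminant root, which exchanging two roots of the cubic adjusts.
\<close>

lemma invariants_surj:
  assumes u: "u \<in> discriminant_curve"
  obtains v where "v \<in> bring_cone" "invariants v = u"
proof -
  let ?s = "u $ 1" and ?p = "u $ 2"
  obtain a b where ab: "a + b = ?s" "a * b = ?p" by (rule quadratic_roots)
  obtain x y z where xyz: "x + y + z = - ?s" "x * y + y * z + z * x = ?s\<^sup>2 - ?p"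
    "x * y * z = 2 * ?s * ?p - ?s ^ 3" by (rule cubic_roots)
  have "((x - y) * (y - z) * (z - x))\<^sup>2 = (u $ 3)\<^sup>2"
    using u unfolding discriminant_curve_def cubic_discriminant[OF xyz] discriminant_curve_identity by simp
  then have "(x - y) * (y - z) * (z - x) = u $ 3 \<or> (x - y) * (y - z) * (z - x) = - u $ 3"
    by (simp add: power2_eq_iff)
  moreover have "(x - z) * (z - y) * (y - x) = - ((x - y) * (y - z) * (z - x))" by algebra
  ultimately obtain y' z' where yz': "y' = y \<and> z' = z \<or> y' = z \<and> z' = y"
    and \<delta>: "(x - y') * (y' - z') * (z' - x) = u $ 3" by (metis minus_minus)
  have xyz': "x + y' + z' = - ?s" "x * y' + y' * z' + z' * x = ?s\<^sup>2 - ?p"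
    "x * y' * z' = 2 * ?s * ?p - ?s ^ 3"
    using yz' xyz by (auto simp: algebra_simps)
  define v :: "complex ^ 5" where
    "v = (\<chi> i. if i = 1 then a else if i = 2 then b else if i = 3 then x else if i = 4 then y' else z')"
  have v: "v $ 1 = a" "v $ 2 = b" "v $ 3 = x" "v $ 4 = y'" "v $ 5 = z'" by (simp_all add: v_def)
  show ?thesis
  proof (rule that[of v])
    show "v \<in> bring_cone" unfolding bring_cone_iff Let_def v ab using xyz' by blast
    show "invariants v = u" by (rule vec3_eqI) (simp_all add: invariants_def v ab \<delta>)
  qed
qed

lemma bring_map_surj:
  assumes w: "w \<in> model_cone" "w \<noteq> 0"
  obtains v c where "v \<in> bring_cone" "c \<noteq> 0" "bring_map v = c *s w"
proof -
  define \<kappa> where "\<kappa> = 48 * \<i> * complex_of_real (sqrt 3)"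
  have \<kappa>: "\<kappa>\<^sup>2 = - 6912" "\<kappa> \<noteq> 0" unfolding \<kappa>_def by (rule model_constant)+
  have eq: "(w $ 2)\<^sup>2 * w $ 3 =
     432 * ((w $ 1) ^ 3 + 80 * (w $ 1)\<^sup>2 * w $ 3 + 125 * w $ 1 * (w $ 3)\<^sup>2 + 50 * (w $ 3) ^ 3)"
    using w(1) by (simp add: model_cone_def)
  have "\<exists>u c. u \<in> discriminant_curve \<and> c \<noteq> 0 \<and> model_map u = c *s w"
  proof (cases "w $ 3 = 0")
    case True
    then have w1: "w $ 1 = 0" using eq by simp
    have w2: "w $ 2 \<noteq> 0" using w(2) True w1 by (metis vec3_eqI zero_index)
    \<comment> \<open>Over the point at infinity \<open>u\<^sub>1 = 0\<close>, and the curve reduces to \<open>u\<^sub>3\<^sup>2 = 4 u\<^sub>2\<^sup>3\<close>.\<close>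
    let ?u = "vector [0, 1, 2] :: complex ^ 3"
    have "?u \<in> discriminant_curve" by (simp add: discriminant_curve_def)
    moreover have "model_map ?u = (2 * \<kappa> / w $ 2) *s w"
      by (rule vec3_eqI) (use True w1 w2 in \<open>simp_all flip: \<kappa>_def\<close>)
    ultimately show ?thesis using \<kappa>(2) w2 by (intro exI[of _ ?u] exI[of _ "2 * \<kappa> / w $ 2"]) simp
  next
    case False
    define x y where "x = w $ 1 / w $ 3" and "y = w $ 2 / w $ 3"
    have xy: "w $ 1 = x * w $ 3" "w $ 2 = y * w $ 3" using False by (simp_all add: x_def y_def)
    have "(w $ 3) ^ 3 * y\<^sup>2 = (w $ 3) ^ 3 * (432 * (x ^ 3 + 80 * x\<^sup>2 + 125 * x + 50))"
      using eq unfolding xy by algebra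
    then have y2: "y\<^sup>2 = 432 * (x ^ 3 + 80 * x\<^sup>2 + 125 * x + 50)" using False by simp
    let ?u = "vector [1, (1 - x) / 4, y / \<kappa>] :: complex ^ 3"
    have "(y / \<kappa>)\<^sup>2 = 4 * ((1 - x) / 4) ^ 3 - 83 * ((1 - x) / 4)\<^sup>2 + 72 * ((1 - x) / 4) - 16"
      unfolding power_divide \<kappa> y2 by (simp add: field_simps power2_eq_square power3_eq_cube)
    then have "?u \<in> discriminant_curve" by (simp add: discriminant_curve_def)
    moreover have "model_map ?u = (1 / w $ 3) *s w"
      by (rule vec3_eqI) (use False \<kappa>(2) in \<open>simp_all add: x_def y_def diff_divide_distrib flip: \<kappa>_def\<close>)
    ultimately show ?thesis using False by (intro exI[of _ ?u] exI[of _ "1 / w $ 3"]) simp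
  qed
  then obtain u c where "u \<in> discriminant_curve" "c \<noteq> 0" "model_map u = c *s w" by blast
  moreover from this obtain v where "v \<in> bring_cone" "invariants v = u" using invariants_surj by blast
  ultimately show ?thesis using that by (simp add: bring_map_def)
qed

section \<open>The quotient of Bring's curve\<close>

lemma proj_space_subset: "bring_curve \<subseteq> proj_space" "quotient_model \<subseteq> proj_space"
  "weierstrass_curve a1 a2 a3 a4 a6 \<subseteq> proj_space"
  by (auto simp: bring_curve_def quotient_model_def weierstrass_curve_def)

lemma ball_line_iff:
  assumes "\<And>c. A v \<Longrightarrow> A (c *s v)"
  shows "(\<forall>x\<in>vec.span {v}. A x) \<longleftrightarrow> A v"
proof
  assume "\<forall>x\<in>vec.span {v}. A x"
  then show "A v" by (rule bspec) (simp add: vec.span_base)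
next
  assume "A v"
  then show "\<forall>x\<in>vec.span {v}. A x" using assms by (auto simp: span_line)
qed

lemma line_in_bring_curve:
  assumes "v \<noteq> 0"
  shows "vec.span {v} \<in> bring_curve \<longleftrightarrow> v \<in> bring_cone"
proof -
  have "vec.span {v} \<in> bring_curve \<longleftrightarrow> (\<forall>x\<in>vec.span {v}. x \<in> bring_cone)"
    using line_in_proj_space[OF assms] by (simp add: bring_curve_def bring_cone_def)
  also have "\<dots> \<longleftrightarrow> v \<in> bring_cone"
    by (rule ball_line_iff) (rule bring_cone_scale)
  finally show ?thesis .
qed

lemma model_cone_scale: "v \<in> model_cone \<Longrightarrow> c *s v \<in> model_cone"
  unfolding model_cone_def mem_Collect_eq vector_smult_component by algebra

lemma line_in_quotient_model:
  assumes "v \<noteq> 0"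
  shows "vec.span {v} \<in> quotient_model \<longleftrightarrow> v \<in> model_cone"
proof -
  have "vec.span {v} \<in> quotient_model \<longleftrightarrow> (\<forall>x\<in>vec.span {v}. x \<in> model_cone)"
    using line_in_proj_space[OF assms] by (simp add: quotient_model_def model_cone_def)
  also have "\<dots> \<longleftrightarrow> v \<in> model_cone"
    by (rule ball_line_iff) (rule model_cone_scale)
  finally show ?thesis .
qed

lemma bring_curveE:
  assumes "L \<in> bring_curve"
  obtains v where "v \<noteq> 0" "v \<in> bring_cone" "L = vec.span {v}"
  using assms proj_space_subset(1) line_in_bring_curve by (metis proj_spaceE subsetD)

definition quotient_map :: "(complex ^ 5) set \<Rightarrow> (complex ^ 3) set" where
  "quotient_map = proj_map bring_map"

lemma quotient_map_line: "quotient_map (vec.span {v}) = vec.span {bring_map v}"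
  unfolding quotient_map_def by (rule proj_map_line[OF form_bring_map])

lemma bring_map_in_model:
  assumes "v \<in> bring_cone" "v \<noteq> 0"
  shows "vec.span {bring_map v} \<in> quotient_model"
  using bring_map_nonzero[OF assms] model_map_in_cone invariants_in_discriminant_curve[OF assms(1)]
  by (simp add: line_in_quotient_model bring_map_def)

lemma quotient_modelE:
  assumes "M \<in> quotient_model"
  obtains v where "v \<noteq> 0" "v \<in> bring_cone" "M = quotient_map (vec.span {v})"
proof -
  obtain w where w: "w \<noteq> 0" "M = vec.span {w}"
    using assms proj_space_subset(2) by (meson proj_spaceE subsetD)
  then have "w \<in> model_cone" using assms line_in_quotient_model by simp
  with w obtain v c where v: "v \<in> bring_cone" "c \<noteq> 0" "bring_map v = c *s w"
    using bring_map_surj by blast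
  have "bring_map 0 = 0"
    by (rule vec3_eqI) (simp_all add: bring_map_def invariants_def)
  then have "v \<noteq> 0" using v w(1) by auto
  then show ?thesis
    using that v w(2) line_eqI[OF v(3,2)] by (simp add: quotient_map_line)
qed

lemma funpow_nonzero:
  assumes "v \<noteq> 0"
  shows "(rot_vec ^^ i) ((swap_vec ^^ j) v) \<noteq> 0"
proof -
  have r: "rot_vec x \<noteq> 0" and s: "swap_vec x \<noteq> 0" if "x \<noteq> 0" for x
  proof -
    show "rot_vec x \<noteq> 0"
    proof
      assume "rot_vec x = 0"
      then have "rot_vec x $ k = 0" for k by simp
      from this[of 1] this[of 2] this[of 3] this[of 4] this[of 5] have "x = 0"
        by (intro vec5_eqI) simp_all
      with that show False ..
    qed
    show "swap_vec x \<noteq> 0"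
    proof
      assume "swap_vec x = 0"
      then have "swap_vec x $ k = 0" for k by simp
      from this[of 1] this[of 2] this[of 3] this[of 4] this[of 5] have "x = 0"
        by (intro vec5_eqI) simp_all
      with that show False ..
    qed
  qed
  have "(swap_vec ^^ j) v \<noteq> 0" by (induction j) (simp_all add: assms s)
  then show ?thesis by (induction i) (simp_all add: r)
qed

lemma quotient_map_funpow:
  "quotient_map (vec.span {(rot_vec ^^ i) ((swap_vec ^^ j) v)}) = quotient_map (vec.span {v})"
  by (simp add: quotient_map_line bring_map_def invariants_funpow)

text \<open>
  Points with the same image have, after rescaling one of them, equal invariants, and then a group
  element moves one to the other.
\<close>

lemma orbit_eq_fibre:
  assumes "L \<in> bring_curve"
  shows "orbit (subgroup_generated S5 {transposition, three_cycle}) permute_coords L =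
    {L' \<in> bring_curve. quotient_map L' = quotient_map L}"
proof -
  obtain v where v: "v \<noteq> 0" "v \<in> bring_cone" "L = vec.span {v}"
    using assms by (rule bring_curveE)
  show ?thesis
    unfolding v(3) orbit_line
  proof (intro subset_antisym subsetI)
    fix L' assume "L' \<in> {vec.span {(rot_vec ^^ i) ((swap_vec ^^ j) v)} | i j. True}"
    then obtain i j where "L' = vec.span {(rot_vec ^^ i) ((swap_vec ^^ j) v)}" by blast
    then show "L' \<in> {L' \<in> bring_curve. quotient_map L' = quotient_map (vec.span {v})}"
      using quotient_map_funpow funpow_nonzero[OF v(1)] bring_cone_funpow[OF v(2)]
      by (simp add: line_in_bring_curve)
  next
    fix L' assume "L' \<in> {L' \<in> bring_curve. quotient_map L' = quotient_map (vec.span {v})}"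
    then have L': "L' \<in> bring_curve" "quotient_map L' = quotient_map (vec.span {v})" by auto
    obtain w where w: "w \<noteq> 0" "w \<in> bring_cone" "L' = vec.span {w}"
      using L'(1) by (rule bring_curveE)
    have "vec.span {bring_map w} = vec.span {bring_map v}"
      using L'(2) w(3) by (simp add: quotient_map_line)
    then obtain c where "c \<noteq> 0" "bring_map w = c *s bring_map v"
      using line_eqD bring_map_nonzero[OF w(2,1)] by blast
    then obtain l where l: "l \<noteq> 0" "invariants w = invariants (l *s v)"
      using bring_map_fibre[OF w(2) v(2,1)] by blast
    obtain i' j' where "w = (rot_vec ^^ i') ((swap_vec ^^ j') (l *s v))"
      using same_invariants[OF bring_cone_scale[OF v(2)] w(2) l(2)[symmetric]] by blast
    moreover have "(rot_vec ^^ i) ((swap_vec ^^ j) (c *s x)) = c *s (rot_vec ^^ i) ((swap_vec ^^ j) x)"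
      for c x i j
    proof -
      have r: "rot_vec (c *s x) = c *s rot_vec x" and s: "swap_vec (c *s x) = c *s swap_vec x" for x
        by (rule vec5_eqI; simp)+
      have "(swap_vec ^^ j) (c *s x) = c *s (swap_vec ^^ j) x" by (induction j) (simp_all add: s)
      moreover have "(rot_vec ^^ i) (c *s y) = c *s (rot_vec ^^ i) y" for y
        by (induction i) (simp_all add: r)
      ultimately show ?thesis by simp
    qed
    ultimately have "vec.span {w} = vec.span {(rot_vec ^^ i') ((swap_vec ^^ j') v)}"
      using line_eqI l(1) by blast
    then show "L' \<in> {vec.span {(rot_vec ^^ i) ((swap_vec ^^ j) v)} | i j. True}"
      using w(3) by blast
  qed
qed

text \<open>
  A form that is nonzero at a point and vanishes off a saturated open set keeps this second property
  when translated by the group, hence also when a power of it is symmetrised. The result is the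
  pullback of a form on the plane, whose nonvanishing set is then a neighbourhood in the image.
\<close>

lemma quotient_map_open:
  assumes V: "V \<subseteq> quotient_model"
    and open_preimage: "openin (zariski bring_curve) {L \<in> bring_curve. quotient_map L \<in> V}"
  shows "openin (zariski quotient_model) V"
  unfolding openin_zariski_iff[OF proj_space_subset(2)]
proof (intro conjI ballI)
  let ?W = "{L \<in> bring_curve. quotient_map L \<in> V}"
  fix M assume M: "M \<in> V"
  then obtain v where v: "v \<noteq> 0" "v \<in> bring_cone" "M = quotient_map (vec.span {v})"
    using V quotient_modelE by blast
  then have "vec.span {v} \<in> ?W" using M line_in_bring_curve by simp
  then obtain d F where F: "form d F" "vec.span {v} \<in> nonvanishing bring_curve F"
    "nonvanishing bring_curve F \<subseteq> ?W"
    using open_preimage unfolding openin_zariski_iff[OF proj_space_subset(1)] by blast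
  then have "F v \<noteq> 0" using line_in_nonvanishing[OF F(1) v(1)] by blast
  then obtain k where k: "k > 0" "symmetrise (\<lambda>v. F v ^ (3 * k)) v \<noteq> 0"
    by (rule symmetrise_power_nonzero)
  have "form (3 * (d * k)) (\<lambda>v. F v ^ (3 * k))"
    using form_power[OF F(1), of "3 * k"] by (simp add: mult_ac)
  then obtain \<Phi> where \<Phi>: "form (d * k) \<Phi>"
    "\<And>v. v \<in> bring_cone \<Longrightarrow> symmetrise (\<lambda>v. F v ^ (3 * k)) v = \<Phi> (bring_map v)"
    using symmetrise_pullback by blast
  show "\<exists>d F. form d F \<and> M \<in> nonvanishing quotient_model F \<and> nonvanishing quotient_model F \<subseteq> V"
  proof (intro exI conjI subsetI)
    show "form (d * k) \<Phi>" by (rule \<Phi>)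
    show "M \<in> nonvanishing quotient_model \<Phi>"
      using k(2) \<Phi>(2)[OF v(2)] bring_map_in_model[OF v(2,1)]
        line_in_nonvanishing[OF \<Phi>(1) bring_map_nonzero[OF v(2,1)]]
      by (simp add: v(3) quotient_map_line)
    fix M' assume M': "M' \<in> nonvanishing quotient_model \<Phi>"
    then have "M' \<in> quotient_model" by (simp add: nonvanishing_def)
    then obtain w where w: "w \<noteq> 0" "w \<in> bring_cone" "M' = quotient_map (vec.span {w})"
      by (rule quotient_modelE)
    then have "\<Phi> (bring_map w) \<noteq> 0"
      using M' line_in_nonvanishing[OF \<Phi>(1) bring_map_nonzero[OF w(2,1)]]
      by (simp add: quotient_map_line)
    then have "symmetrise (\<lambda>v. F v ^ (3 * k)) w \<noteq> 0" using \<Phi>(2)[OF w(2)] by simp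
    then obtain i j where "F ((rot_vec ^^ i) ((swap_vec ^^ j) w)) ^ (3 * k) \<noteq> 0"
      by (rule symmetrise_nonzero)
    then have "F ((rot_vec ^^ i) ((swap_vec ^^ j) w)) \<noteq> 0" using k(1) by simp
    moreover have nz: "(rot_vec ^^ i) ((swap_vec ^^ j) w) \<noteq> 0" by (rule funpow_nonzero[OF w(1)])
    ultimately have "vec.span {(rot_vec ^^ i) ((swap_vec ^^ j) w)} \<in> nonvanishing bring_curve F"
      using line_in_nonvanishing[OF F(1) nz] line_in_bring_curve[OF nz] bring_cone_funpow[OF w(2)]
      by simp
    then have "quotient_map (vec.span {(rot_vec ^^ i) ((swap_vec ^^ j) w)}) \<in> V" using F(3) by blast
    then show "M' \<in> V" by (simp add: quotient_map_funpow w(3))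
  qed
qed (use V in blast)

text \<open>
  An identity \<open>f G = F\<close> with \<open>f\<close> invariant may be multiplied by \<open>G\<^sup>n\<close> and summed over the group:
  this replaces \<open>F\<close> and \<open>G\<close> by invariant forms, and those come from the cubic.
\<close>

lemma quotient_map_reflects_regular:
  assumes V: "openin (zariski quotient_model) V"
    and preimage: "openin (zariski bring_curve) {L \<in> bring_curve. quotient_map L \<in> V}"
    and f: "regular_on bring_curve {L \<in> bring_curve. quotient_map L \<in> V} (f \<circ> quotient_map)"
  shows "regular_on quotient_model V f"
  unfolding regular_on_iff[OF proj_space_subset(2) V]
proof
  let ?W = "{L \<in> bring_curve. quotient_map L \<in> V}"
  have VY: "V \<subseteq> quotient_model" using V unfolding openin_zariski_iff[OF proj_space_subset(2)] by blast
  fix M assume M: "M \<in> V"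
  then obtain v where v: "v \<noteq> 0" "v \<in> bring_cone" "M = quotient_map (vec.span {v})"
    using VY quotient_modelE by blast
  then have "vec.span {v} \<in> ?W" using M line_in_bring_curve by simp
  from bspec[OF iffD1[OF regular_on_iff[OF proj_space_subset(1) preimage] f] this]
  obtain d F G where F: "form d F" "form d G" "\<forall>x\<in>vec.span {v} - {0}. G x \<noteq> 0"
    and eq: "\<forall>L\<in>?W. \<forall>x\<in>L - {0}. (f \<circ> quotient_map) L * G x = F x"
    by (elim exE conjE) (rule that)
  have "G v \<noteq> 0" using F(3) v(1) by (simp add: vec.span_base)
  then obtain k where k: "k > 0" "symmetrise (\<lambda>v. G v ^ (3 * k)) v \<noteq> 0"
    by (rule symmetrise_power_nonzero)
  define D N where "D x = G x ^ (3 * k)" and "N x = F x * G x ^ (3 * k - 1)" for x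
  have Dv: "symmetrise D v \<noteq> 0" using k(2) by (simp add: D_def[abs_def])
  have "form (3 * (d * k)) D"
    unfolding D_def using form_power[OF F(2), of "3 * k"] by (simp add: mult_ac)
  then obtain \<Delta> where \<Delta>: "form (d * k) \<Delta>"
    "\<And>v. v \<in> bring_cone \<Longrightarrow> symmetrise D v = \<Delta> (bring_map v)"
    using symmetrise_pullback by blast
  have "3 * (d * k) = d + d * (3 * k - 1)"
    using k(1) by (simp add: algebra_simps diff_mult_distrib2)
  then have "form (3 * (d * k)) N"
    unfolding N_def using form_mult'[OF F(1) form_power[OF F(2), of "3 * k - 1"]] by blast
  then obtain \<Gamma> where \<Gamma>: "form (d * k) \<Gamma>"
    "\<And>v. v \<in> bring_cone \<Longrightarrow> symmetrise N v = \<Gamma> (bring_map v)"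
    using symmetrise_pullback by blast
  have fDN: "f (quotient_map (vec.span {x})) * D x = N x"
    if "x \<noteq> 0" "x \<in> bring_cone" "quotient_map (vec.span {x}) \<in> V" for x
  proof -
    have "f (quotient_map (vec.span {x})) * G x = F x"
      using eq that line_in_bring_curve[OF that(1)] vec.span_base[of x "{x}"] by simp
    moreover have "D x = G x * G x ^ (3 * k - 1)"
      unfolding D_def using k(1) by (simp flip: power_Suc)
    ultimately show ?thesis by (simp add: N_def mult.assoc[symmetric])
  qed
  have sym: "f (quotient_map (vec.span {x})) * symmetrise D x = symmetrise N x"
    if "x \<noteq> 0" "x \<in> bring_cone" "quotient_map (vec.span {x}) \<in> V" for x
    unfolding symmetrise_def sum_distrib_left
  proof (rule sum.cong[OF refl], clarify)
    fix i j
    have "f (quotient_map (vec.span {(rot_vec ^^ i) ((swap_vec ^^ j) x)})) *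
        D ((rot_vec ^^ i) ((swap_vec ^^ j) x)) = N ((rot_vec ^^ i) ((swap_vec ^^ j) x))"
      using that by (intro fDN funpow_nonzero bring_cone_funpow) (simp_all add: quotient_map_funpow)
    then show "f (quotient_map (vec.span {x})) * D ((rot_vec ^^ i) ((swap_vec ^^ j) x)) =
        N ((rot_vec ^^ i) ((swap_vec ^^ j) x))"
      by (simp add: quotient_map_funpow)
  qed
  show "\<exists>d F G. form d F \<and> form d G \<and> (\<forall>w\<in>M - {0}. G w \<noteq> 0) \<and>
      (\<forall>L\<in>V. \<forall>w\<in>L - {0}. f L * G w = F w)"
  proof (intro exI conjI)
    show "form (d * k) \<Gamma>" "form (d * k) \<Delta>" by (rule \<Gamma> \<Delta>)+
    have "M \<in> nonvanishing quotient_model \<Delta>"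
      using Dv \<Delta>(2)[OF v(2)] bring_map_in_model[OF v(2,1)]
        line_in_nonvanishing[OF \<Delta>(1) bring_map_nonzero[OF v(2,1)]]
      by (simp add: v(3) quotient_map_line)
    then show "\<forall>w\<in>M - {0}. \<Delta> w \<noteq> 0" by (simp add: nonvanishing_def)
    show "\<forall>L\<in>V. \<forall>w\<in>L - {0}. f L * \<Delta> w = \<Gamma> w"
    proof (intro ballI)
      fix L w assume L: "L \<in> V" "w \<in> L - {0}"
      then obtain x where x: "x \<noteq> 0" "x \<in> bring_cone" "L = quotient_map (vec.span {x})"
        using VY quotient_modelE by blast
      have "w \<in> vec.span {bring_map x}" using L(2) by (simp add: x(3) quotient_map_line)
      then obtain c where c: "w = c *s bring_map x" by (auto simp: span_line)
      have "f L * \<Delta> (bring_map x) = \<Gamma> (bring_map x)"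
        using sym[OF x(1,2)] L(1) by (simp add: x(3) \<Delta>(2)[OF x(2)] \<Gamma>(2)[OF x(2)])
      then show "f L * \<Delta> w = \<Gamma> w"
        by (simp add: c form_scale[OF \<Delta>(1)] form_scale[OF \<Gamma>(1)] mult.left_commute)
    qed
  qed
qed

lemma bring_quotient_isomorphic:
  "isomorphic
     (quotient_space (variety bring_curve)
        (subgroup_generated S5 {transposition, three_cycle}) permute_coords)
     (variety quotient_model)"
proof (rule quotient_isomorphic[where \<pi> = quotient_map])
  show "bring_curve \<subseteq> proj_space" "quotient_model \<subseteq> proj_space" by (rule proj_space_subset)+
  show mor: "morphism (variety bring_curve) (variety quotient_model) quotient_map"
    unfolding quotient_map_def
    using bring_map_nonzero bring_map_in_model line_in_bring_curve
    by (intro morphism_by_forms[OF proj_space_subset(1,2) form_bring_map]) blast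
  show "quotient_map ` bring_curve = quotient_model"
  proof (intro subset_antisym subsetI)
    fix M assume "M \<in> quotient_map ` bring_curve"
    then show "M \<in> quotient_model"
      by (metis bring_curveE bring_map_in_model imageE quotient_map_line)
  next
    fix M assume "M \<in> quotient_model"
    then show "M \<in> quotient_map ` bring_curve"
      by (metis imageI line_in_bring_curve quotient_modelE)
  qed
  show "orbit (subgroup_generated S5 {transposition, three_cycle}) permute_coords L =
      {L' \<in> bring_curve. quotient_map L' = quotient_map L}" if "L \<in> bring_curve" for L
    by (rule orbit_eq_fibre[OF that])
  show "openin (zariski quotient_model) V"
    if "V \<subseteq> quotient_model" "openin (zariski bring_curve) {L \<in> bring_curve. quotient_map L \<in> V}" for V
    by (rule quotient_map_open[OF that])
  show "regular_on quotient_model V f" if V: "openin (zariski quotient_model) V"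
    and f: "regular_on bring_curve {L \<in> bring_curve. quotient_map L \<in> V} (f \<circ> quotient_map)" for V f
  proof (rule quotient_map_reflects_regular[OF V _ f])
    show "openin (zariski bring_curve) {L \<in> bring_curve. quotient_map L \<in> V}"
      using mor V
      by (simp add: morphism_def continuous_map_def variety_def topspace_zariski proj_space_subset)
  qed
qed


section \<open>The j-invariant\<close>

text \<open>
  Multiplying the equation by \<open>432\<^sup>2\<close> and absorbing the factor into \<open>x\<close> and \<open>y\<close> makes it monic.
\<close>

lemma quotient_model_elliptic:
  "elliptic_curve_with_j (variety quotient_model) (- (5\<^sup>2 * 241 ^ 3 / 2 ^ 3))"
proof -
  let ?E = "weierstrass_curve 0 (80 * 432) 0 (125 * 432\<^sup>2) (50 * 432 ^ 3)"
  define P R :: "complex ^ 3 \<Rightarrow> complex ^ 3" where "P v = vector [432 * v $ 1, 432 * v $ 2, v $ 3]"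
    and "R v = vector [v $ 1, v $ 2, 432 * v $ 3]" for v
  have P: "form 1 (\<lambda>v. P v $ i)" for i
    using exhaust_3[of i] form_smult[OF form_coord, of 432] form_coord by (auto simp: P_def)
  have R: "form 1 (\<lambda>v. R v $ i)" for i
    using exhaust_3[of i] form_smult[OF form_coord, of 432] form_coord by (auto simp: R_def)
  have RP: "R (P v) = 432 *s v" and PR: "P (R v) = 432 *s v" for v
    by (rule vec3_eqI; simp add: P_def R_def)+
  have zero: "P 0 = 0" "R 0 = 0" by (rule vec3_eqI; simp add: P_def R_def)+
  have nz: "P v \<noteq> 0" "R v \<noteq> 0" if "v \<noteq> 0" for v
    using that RP[of v] PR[of v] zero by auto
  have line_E: "vec.span {v} \<in> ?E \<longleftrightarrow> (v $ 2)\<^sup>2 * v $ 3 =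
      v $ 1 ^ 3 + 80 * 432 * (v $ 1)\<^sup>2 * v $ 3 + 125 * 432\<^sup>2 * v $ 1 * (v $ 3)\<^sup>2 + 50 * 432 ^ 3 * v $ 3 ^ 3"
    (is "_ \<longleftrightarrow> ?eq v") if "v \<noteq> 0" for v
  proof -
    have "?eq (c *s v)" if "?eq v" for c
      using that unfolding vector_smult_component by algebra
    moreover have "vec.span {v} \<in> ?E \<longleftrightarrow> (\<forall>x\<in>vec.span {v}. ?eq x)"
      using line_in_proj_space[OF that] by (simp add: weierstrass_curve_def)
    moreover have "(\<forall>x\<in>vec.span {v}. ?eq x) \<longleftrightarrow> ?eq v"
      by (rule ball_line_iff) (rule calculation(1))
    ultimately show ?thesis by (simp only:)
  qed
  have P_E: "vec.span {P v} \<in> ?E" if "v \<noteq> 0" "vec.span {v} \<in> quotient_model" for v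
  proof -
    have "v \<in> model_cone" using that line_in_quotient_model by blast
    then show ?thesis
      unfolding line_E[OF nz(1)[OF that(1)]]
      unfolding model_cone_def P_def vector_3 mem_Collect_eq by algebra
  qed
  have R_model: "vec.span {R v} \<in> quotient_model" if "v \<noteq> 0" "vec.span {v} \<in> ?E" for v
    using that(2) unfolding line_E[OF that(1)] line_in_quotient_model[OF nz(2)[OF that(1)]]
    unfolding model_cone_def R_def vector_3 mem_Collect_eq by algebra
  have "morphism (variety quotient_model) (variety ?E) (proj_map P)"
    using nz(1) P_E by (intro morphism_by_forms[OF proj_space_subset(2,3) P]) blast
  moreover have "morphism (variety ?E) (variety quotient_model) (proj_map R)"
    using nz(2) R_model by (intro morphism_by_forms[OF proj_space_subset(3,2) R]) blast
  moreover have "proj_map R (proj_map P L) = L" "proj_map P (proj_map R L) = L" if "L \<in> proj_space" for L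
  proof -
    obtain v where "L = vec.span {v}" using \<open>L \<in> proj_space\<close> by (rule proj_spaceE)
    then show "proj_map R (proj_map P L) = L" "proj_map P (proj_map R L) = L"
      using line_eqI[of "432 *s v" 432 v] by (simp_all add: proj_map_line[OF P] proj_map_line[OF R] RP PR)
  qed
  ultimately have iso: "isomorphic (variety quotient_model) (variety ?E)"
    unfolding isomorphic_def using proj_space_subset(2,3)
    by (intro exI[of _ "proj_map P"] exI[of _ "proj_map R"] conjI ballI)
      (simp_all add: variety_def topspace_zariski proj_space_subset subset_iff)
  have disc: "weierstrass_disc 0 (80 * 432) 0 (125 * 432\<^sup>2) (50 * 432 ^ 3) = - 20480000 * 432 ^ 6"
    by (simp add: weierstrass_disc_def Let_def)
  then have j: "weierstrass_j 0 (80 * 432) 0 (125 * 432\<^sup>2) (50 * 432 ^ 3) = - (5\<^sup>2 * 241 ^ 3 / 2 ^ 3)"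
    by (simp add: weierstrass_j_def weierstrass_c4_def)
  have nz_disc: "weierstrass_disc 0 (80 * 432) 0 (125 * 432\<^sup>2) (50 * 432 ^ 3) \<noteq> 0"
    unfolding disc by simp
  show ?thesis
    unfolding elliptic_curve_with_j_def
    by ((rule exI)+, rule conjI[OF nz_disc conjI[OF iso j]])
qed

theorem mainTheorem8:
  shows "isomorphic
           (quotient_space (variety bring_curve)
              (subgroup_generated S5 {cycle_of_list [1, 2], cycle_of_list [3, 4, 5]})
              permute_coords)
           (variety quotient_model)
         \<and> elliptic_curve_with_j (variety quotient_model) (- (5\<^sup>2 * 241 ^ 3 / 2 ^ 3))"
  using bring_quotient_isomorphic quotient_model_elliptic
  by (simp only: transposition_def three_cycle_def simp_thms)

end
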